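(* Let $\Lambda$ be a finite dimensional algebra over a field $K$ and let $Z_\bullet$ be a nonlinear stability function for $\Lambda$ with corresponding path $\gamma_Z$. Then $Z_\bullet$ is finite if and only if $\gamma_Z$ is finite.
   Context: $\text{mod-}\Lambda$ is the category of finite dimensional right $\Lambda$-modules, with simple objects $S_1,\dots,S_n$; $\underline{\dim}\,M\in\mathbb N^n$ records the multiplicities of the $S_i$ in a composition series of $M$, and $K_0\Lambda=\mathbb Z^n$. For $M\neq0$: $H(M)=\{x\in\mathbb R^n:x\cdot\underline{\dim}\,M=0\}$; $D(M)=\{x\in H(M):x\cdot\underline{\dim}\,M'\le0\text{ for all }M'\subseteq M\}$. A nonlinear stability function is a $C^1$ family of additive maps $Z_t:\mathbb Z^n\to\mathbb C$, $t\in\mathbb R$, $Z_t(x)=a_t\cdot x+\sqrt{-1}\,b_t\cdot x$ with $a_t\in\mathbb R^n$, $b_t\in(0,\infty)^n$, such that $a_t,b_t$ have velocity $0$ for $|t|$ large. For $M\ne0$, $\mu_t(M)=\frac{a_t\cdot\underline{\dim}\,M}{b_t\cdot\underline{\dim}\,M}$; $M$ is $Z_t$-semistable if $\mu_t(M')\ge\mu_t(M)$ for all nonzero $M'\subsetneq M$. $(M,t_0)$ is a semistable pair if $M$ is $Z_{t_0}$-semistable and $\mu_{t_0}(M)=t_0$. $Z_\bullet$ is generic if $\frac{d}{dt}\mu_t(M)|_{t=t_0}\ne1$ for every semistable pair $(M,t_0)$. The corresponding path is $\gamma_Z(t)=t\,b_t-a_t$. $Z_\bullet$ is finite if it is generic,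 there are only finitely many semistable pairs $(M_i,t_i)$ with $M_i$ indecomposable, up to isomorphism, and the $t_i$ are all distinct. A reddening path is a $C^1$ path $\gamma:\mathbb R\to\mathbb R^n$ such that all coordinates of $\gamma(t)$ are negative for $t\ll0$ and positive for $t\gg0$, and whenever $\gamma(t_0)\in D(M)$ for a nonzero module $M$, the crossing is transverse, i.e. $D(M)$ has codimension 1 and $\gamma$ is not tangent to the hyperplane $H(M)$ at $t_0$. A path $\gamma$ is finite if it is a reddening path, there are only finitely many real numbers $t_i$ such that $\gamma(t_i)$ lies in some $D(M_i)$ with $M_i$ indecomposable, and for each $t_i$ the indecomposable module $M_i$ is uniquely determined up to isomorphism. *)

theory Defs
  imports "HOL-Algebra.Module" "HOL-Algebra.AbelCoset" "HOL-Analysis.Analysis"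
begin

section \<open>Right modules over a ring\<close>

text \<open>
  A right \<open>\<Lambda>\<close>-module is stored in the record \<^type>\<open>module\<close> of HOL-Algebra (whose locale
  \<open>module\<close> requires a commutative ring and is therefore not used for \<open>\<Lambda>\<close>-modules).
  The value \<open>a \<odot>\<^bsub>M\<^esub> x\<close> is the right action \<open>x \<cdot> a\<close>; this is why associativity
  reverses the order of the factors.  The fields \<open>mult\<close> and \<open>one\<close> of the record carry
  no information.  Submodules are the \<open>submodule N \<Lambda> M\<close> of HOL-Algebra, which
  only refers to the additive group of \<open>M\<close> and to \<open>\<odot>\<close>; as a module of its own, such an
  \<open>N\<close> is \<open>M\<lparr>carrier := N\<rparr>\<close>.
\<close>

locale right_module = R?: Ring.ring \<Lambda> + M?: abelian_group M
  for \<Lambda> :: "('a, 'r) ring_scheme" (structure) and M :: "('a, 'm) module" (structure) +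
  assumes act_closed: "\<lbrakk>a \<in> carrier \<Lambda>; x \<in> carrier M\<rbrakk> \<Longrightarrow> a \<odot>\<^bsub>M\<^esub> x \<in> carrier M"
    and act_add_scalar: "\<lbrakk>a \<in> carrier \<Lambda>; b \<in> carrier \<Lambda>; x \<in> carrier M\<rbrakk> \<Longrightarrow>
      (a \<oplus>\<^bsub>\<Lambda>\<^esub> b) \<odot>\<^bsub>M\<^esub> x = a \<odot>\<^bsub>M\<^esub> x \<oplus>\<^bsub>M\<^esub> b \<odot>\<^bsub>M\<^esub> x"
    and act_add: "\<lbrakk>a \<in> carrier \<Lambda>; x \<in> carrier M; y \<in> carrier M\<rbrakk> \<Longrightarrow>
      a \<odot>\<^bsub>M\<^esub> (x \<oplus>\<^bsub>M\<^esub> y) = a \<odot>\<^bsub>M\<^esub> x \<oplus>\<^bsub>M\<^esub> a \<odot>\<^bsub>M\<^esub> y"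
    and act_mult: "\<lbrakk>a \<in> carrier \<Lambda>; b \<in> carrier \<Lambda>; x \<in> carrier M\<rbrakk> \<Longrightarrow>
      (a \<otimes>\<^bsub>\<Lambda>\<^esub> b) \<odot>\<^bsub>M\<^esub> x = b \<odot>\<^bsub>M\<^esub> (a \<odot>\<^bsub>M\<^esub> x)"
    and act_one: "x \<in> carrier M \<Longrightarrow> \<one>\<^bsub>\<Lambda>\<^esub> \<odot>\<^bsub>M\<^esub> x = x"

definition nonzero_module :: "('a, 'm) module \<Rightarrow> bool" where
  "nonzero_module M \<longleftrightarrow> carrier M \<noteq> {\<zero>\<^bsub>M\<^esub>}"

definition isomorphic_modules ::
    "('a, 'r) ring_scheme \<Rightarrow> ('a, 'm) module \<Rightarrow> ('a, 'l) module \<Rightarrow> bool" where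
  "isomorphic_modules \<Lambda> M N \<longleftrightarrow>
     (\<exists>f \<in> iso (add_monoid M) (add_monoid N).
        \<forall>a \<in> carrier \<Lambda>. \<forall>x \<in> carrier M. f (a \<odot>\<^bsub>M\<^esub> x) = a \<odot>\<^bsub>N\<^esub> f x)"

definition simple_module :: "('a, 'r) ring_scheme \<Rightarrow> ('a, 'm) module \<Rightarrow> bool" where
  "simple_module \<Lambda> M \<longleftrightarrow>
     nonzero_module M \<and> (\<forall>N. submodule N \<Lambda> M \<longrightarrow> N = {\<zero>\<^bsub>M\<^esub>} \<or> N = carrier M)"

definition indecomposable_module :: "('a, 'r) ring_scheme \<Rightarrow> ('a, 'm) module \<Rightarrow> bool" where
  "indecomposable_module \<Lambda> M \<longleftrightarrow>
     nonzero_module M \<and>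
     (\<forall>A B. submodule A \<Lambda> M \<and> submodule B \<Lambda> M \<and>
        A <+>\<^bsub>M\<^esub> B = carrier M \<and> A \<inter> B = {\<zero>\<^bsub>M\<^esub>} \<longrightarrow>
        A = {\<zero>\<^bsub>M\<^esub>} \<or> B = {\<zero>\<^bsub>M\<^esub>})"

definition quotient_module :: "('a, 'm) module \<Rightarrow> 'm set \<Rightarrow> ('a, 'm set) module" where
  "quotient_module M N =
     \<lparr>carrier = a_rcosets\<^bsub>M\<^esub> N, monoid.mult = undefined, monoid.one = undefined,
      ring.zero = N, ring.add = set_add M,
      module.smult = (\<lambda>a C. \<Union>x\<in>C. N +>\<^bsub>M\<^esub> (a \<odot>\<^bsub>M\<^esub> x))\<rparr>"

text \<open>The factor \<open>N' / N\<close> for submodules \<open>N \<subseteq> N'\<close> of \<open>M\<close>.\<close>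

definition factor_module :: "('a, 'm) module \<Rightarrow> 'm set \<Rightarrow> 'm set \<Rightarrow> ('a, 'm set) module" where
  "factor_module M N' N = quotient_module (M\<lparr>carrier := N'\<rparr>) N"

definition composition_series ::
    "('a, 'r) ring_scheme \<Rightarrow> ('a, 'm) module \<Rightarrow> 'm set list \<Rightarrow> bool" where
  "composition_series \<Lambda> M Ns \<longleftrightarrow>
     Ns \<noteq> [] \<and> hd Ns = {\<zero>\<^bsub>M\<^esub>} \<and> last Ns = carrier M \<and>
     (\<forall>N \<in> set Ns. submodule N \<Lambda> M) \<and>
     (\<forall>k. Suc k < length Ns \<longrightarrow>
        Ns ! k \<subset> Ns ! Suc k \<and> simple_module \<Lambda> (factor_module M (Ns ! Suc k) (Ns ! k)))"

definition finite_dimensional :: "('k, 's) ring_scheme \<Rightarrow> ('k, 'v) module \<Rightarrow> bool" where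
  "finite_dimensional K V \<longleftrightarrow>
     (\<exists>B. finite B \<and> B \<subseteq> carrier V \<and>
        (\<forall>v \<in> carrier V. \<exists>c \<in> B \<rightarrow> carrier K. v = (\<Oplus>\<^bsub>V\<^esub>b\<in>B. c b \<odot>\<^bsub>V\<^esub> b)))"


section \<open>Finite dimensional algebras and their modules\<close>

locale fd_algebra =
  K: Ring.field K + L: Ring.ring \<Lambda> + A: Module.module K \<Lambda>
  for K :: "'k ring" and \<Lambda> :: "('k, 'a) module" +
  assumes smult_mult_left: "\<lbrakk>c \<in> carrier K; x \<in> carrier \<Lambda>; y \<in> carrier \<Lambda>\<rbrakk> \<Longrightarrow>
      c \<odot>\<^bsub>\<Lambda>\<^esub> (x \<otimes>\<^bsub>\<Lambda>\<^esub> y) = (c \<odot>\<^bsub>\<Lambda>\<^esub> x) \<otimes>\<^bsub>\<Lambda>\<^esub> y"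
    and smult_mult_right: "\<lbrakk>c \<in> carrier K; x \<in> carrier \<Lambda>; y \<in> carrier \<Lambda>\<rbrakk> \<Longrightarrow>
      c \<odot>\<^bsub>\<Lambda>\<^esub> (x \<otimes>\<^bsub>\<Lambda>\<^esub> y) = x \<otimes>\<^bsub>\<Lambda>\<^esub> (c \<odot>\<^bsub>\<Lambda>\<^esub> y)"
    and finite_dim: "finite_dimensional K \<Lambda>"
begin

definition underlying_space :: "('a, 'm) module \<Rightarrow> ('k, 'm) module" where
  "underlying_space M =
     \<lparr>carrier = carrier M, monoid.mult = undefined, monoid.one = undefined,
      ring.zero = \<zero>\<^bsub>M\<^esub>, ring.add = ring.add M, module.smult = (\<lambda>c x. (c \<odot>\<^bsub>\<Lambda>\<^esub> \<one>\<^bsub>\<Lambda>\<^esub>) \<odot>\<^bsub>M\<^esub> x)\<rparr>"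

definition fd_module :: "('a, 'm) module \<Rightarrow> bool" where
  "fd_module M \<longleftrightarrow> right_module \<Lambda> M \<and> finite_dimensional K (underlying_space M)"

text \<open>
  The objects of \<open>mod-\<Lambda>\<close>.  HOL cannot quantify over the modules with carriers in all types at
  once, so a single carrier type has to be chosen.  The type \<open>nat \<Rightarrow> 'k\<close> contains a copy of
  \<open>K\<^sup>d\<close> for every \<open>d\<close>, so every finite dimensional right \<open>\<Lambda>\<close>-module, over whatever type, is
  isomorphic to a member of this set.
\<close>

definition mod_objects :: "('a, nat \<Rightarrow> 'k) module set" where
  "mod_objects = {M. fd_module M}"

end

text \<open>\<open>S\<close> is a complete irredundant list of simple modules, indexed by the finite type \<open>'n\<close>.\<close>

locale fd_algebra_simples = fd_algebra K \<Lambda>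
  for K :: "'k ring" and \<Lambda> :: "('k, 'a) module" +
  fixes S :: "'n::finite \<Rightarrow> ('a, nat \<Rightarrow> 'k) module"
  assumes S_mod: "S i \<in> mod_objects"
    and S_simple: "simple_module \<Lambda> (S i)"
    and S_irredundant: "isomorphic_modules \<Lambda> (S i) (S j) \<Longrightarrow> i = j"
    and S_complete: "\<lbrakk>T \<in> mod_objects; simple_module \<Lambda> T\<rbrakk> \<Longrightarrow> \<exists>i. isomorphic_modules \<Lambda> T (S i)"
begin

text \<open>By the Jordan-Hoelder theorem the choice of the composition series is immaterial.\<close>

definition dimension_vector :: "('a, 'm) module \<Rightarrow> nat ^ 'n" where
  "dimension_vector M =
     (let Ns = (SOME Ns. composition_series \<Lambda> M Ns)
      in \<chi> i. card {k. Suc k < length Ns \<and>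
                isomorphic_modules \<Lambda> (factor_module M (Ns ! Suc k) (Ns ! k)) (S i)})"

definition rdim :: "('a, 'm) module \<Rightarrow> real ^ 'n" where
  "rdim M = (\<chi> i. real (dimension_vector M $ i))"

definition H :: "('a, 'm) module \<Rightarrow> (real ^ 'n) set" where
  "H M = {x. x \<bullet> rdim M = 0}"

definition D :: "('a, 'm) module \<Rightarrow> (real ^ 'n) set" where
  "D M = {x \<in> H M. \<forall>N. submodule N \<Lambda> M \<longrightarrow> x \<bullet> rdim (M\<lparr>carrier := N\<rparr>) \<le> 0}"

end


section \<open>Nonlinear stability functions\<close>

text \<open>
  The vectors \<open>a\<^sub>t\<close> and \<open>b\<^sub>t\<close> of a stability function are read off from \<open>Z\<^sub>t\<close> at the unit vectors;
  the first condition in \<open>nonlinear_stability_function\<close> below, which includes the additivity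
  of every \<open>Z\<^sub>t\<close>, says that they determine \<open>Z\<^sub>t\<close>.
\<close>

definition real_path :: "(real \<Rightarrow> int ^ 'n \<Rightarrow> complex) \<Rightarrow> real \<Rightarrow> real ^ 'n" where
  "real_path Z t = (\<chi> i. Re (Z t (axis i 1)))"

definition imag_path :: "(real \<Rightarrow> int ^ 'n \<Rightarrow> complex) \<Rightarrow> real \<Rightarrow> real ^ 'n" where
  "imag_path Z t = (\<chi> i. Im (Z t (axis i 1)))"

definition nonlinear_stability_function :: "(real \<Rightarrow> int ^ 'n \<Rightarrow> complex) \<Rightarrow> bool" where
  "nonlinear_stability_function Z \<longleftrightarrow>
     (\<forall>t x. Z t x = complex_of_real (real_path Z t \<bullet> (\<chi> i. real_of_int (x $ i)))
                  + \<i> * complex_of_real (imag_path Z t \<bullet> (\<chi> i. real_of_int (x $ i)))) \<and>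
     real_path Z C1_differentiable_on UNIV \<and> imag_path Z C1_differentiable_on UNIV \<and>
     (\<forall>t i. imag_path Z t $ i > 0) \<and>
     (\<forall>\<^sub>F t in at_infinity. (real_path Z has_vector_derivative 0) (at t)) \<and>
     (\<forall>\<^sub>F t in at_infinity. (imag_path Z has_vector_derivative 0) (at t))"

definition stability_path :: "(real \<Rightarrow> int ^ 'n \<Rightarrow> complex) \<Rightarrow> real \<Rightarrow> real ^ 'n" where
  "stability_path Z t = t *\<^sub>R imag_path Z t - real_path Z t"

context fd_algebra_simples
begin

definition slope :: "(real \<Rightarrow> int ^ 'n \<Rightarrow> complex) \<Rightarrow> real \<Rightarrow> ('a, 'm) module \<Rightarrow> real" where
  "slope Z t M = (real_path Z t \<bullet> rdim M) / (imag_path Z t \<bullet> rdim M)"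

definition semistable :: "(real \<Rightarrow> int ^ 'n \<Rightarrow> complex) \<Rightarrow> real \<Rightarrow> ('a, 'm) module \<Rightarrow> bool" where
  "semistable Z t M \<longleftrightarrow>
     nonzero_module M \<and>
     (\<forall>N. submodule N \<Lambda> M \<and> N \<noteq> {\<zero>\<^bsub>M\<^esub>} \<and> N \<noteq> carrier M \<longrightarrow>
        slope Z t (M\<lparr>carrier := N\<rparr>) \<ge> slope Z t M)"

definition semistable_pairs ::
    "(real \<Rightarrow> int ^ 'n \<Rightarrow> complex) \<Rightarrow> (('a, nat \<Rightarrow> 'k) module \<times> real) set" where
  "semistable_pairs Z = {(M, t). M \<in> mod_objects \<and> semistable Z t M \<and> slope Z t M = t}"

definition generic_stability :: "(real \<Rightarrow> int ^ 'n \<Rightarrow> complex) \<Rightarrow> bool" where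
  "generic_stability Z \<longleftrightarrow>
     (\<forall>(M, t\<^sub>0) \<in> semistable_pairs Z. deriv (\<lambda>t. slope Z t M) t\<^sub>0 \<noteq> 1)"

text \<open>\<open>P\<close> is a set of representatives for the semistable pairs with indecomposable first component;
  injectivity of \<open>snd\<close> on \<open>P\<close> says that the times occurring in it are pairwise distinct.\<close>

definition finite_stability :: "(real \<Rightarrow> int ^ 'n \<Rightarrow> complex) \<Rightarrow> bool" where
  "finite_stability Z \<longleftrightarrow>
     generic_stability Z \<and>
     (\<exists>P. finite P \<and>
        P \<subseteq> {(M, t) \<in> semistable_pairs Z. indecomposable_module \<Lambda> M} \<and>
        (\<forall>(M, t) \<in> semistable_pairs Z. indecomposable_module \<Lambda> M \<longrightarrow>
           (\<exists>(M', t') \<in> P. isomorphic_modules \<Lambda> M M' \<and> t = t')) \<and>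
        inj_on snd P)"


section \<open>Reddening paths\<close>

text \<open>\<open>D M\<close> is a convex cone, so its dimension is its affine dimension.\<close>

definition reddening_path :: "(real \<Rightarrow> real ^ 'n) \<Rightarrow> bool" where
  "reddening_path \<gamma> \<longleftrightarrow>
     \<gamma> C1_differentiable_on UNIV \<and>
     (\<forall>\<^sub>F t in at_bot. \<forall>i. \<gamma> t $ i < 0) \<and>
     (\<forall>\<^sub>F t in at_top. \<forall>i. \<gamma> t $ i > 0) \<and>
     (\<forall>M \<in> mod_objects. \<forall>t\<^sub>0. nonzero_module M \<and> \<gamma> t\<^sub>0 \<in> D M \<longrightarrow>
        aff_dim (D M) = int CARD('n) - 1 \<and> vector_derivative \<gamma> (at t\<^sub>0) \<notin> H M)"

definition finite_path :: "(real \<Rightarrow> real ^ 'n) \<Rightarrow> bool" where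
  "finite_path \<gamma> \<longleftrightarrow>
     reddening_path \<gamma> \<and>
     finite {t. \<exists>M \<in> mod_objects. indecomposable_module \<Lambda> M \<and> \<gamma> t \<in> D M} \<and>
     (\<forall>t. \<forall>M \<in> mod_objects. \<forall>N \<in> mod_objects.
        indecomposable_module \<Lambda> M \<and> indecomposable_module \<Lambda> N \<and> \<gamma> t \<in> D M \<and> \<gamma> t \<in> D N \<longrightarrow>
        isomorphic_modules \<Lambda> M N)"

end

end

theory Submission
  imports Defs
begin

text \<open>
  For a nonzero module \<open>M\<close> one has \<open>\<gamma>(t) \<bullet> dim M = (b\<^sub>t \<bullet> dim M) (t - \<mu>\<^sub>t(M))\<close>.  Hence \<open>\<gamma>(t) \<in> D(M)\<close>
  if and only if \<open>(M, t)\<close> is a semistable pair, and then differentiation gives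
  \<open>\<gamma>'(t) \<bullet> dim M = (b\<^sub>t \<bullet> dim M) (1 - \<mu>\<^sub>t'(M))\<close>, so that genericity means non-tangency.  What remains is
  that finiteness of \<open>Z\<close> forces \<open>D(M)\<close> to have codimension 1.  Suppose that at time \<open>t\<close> all indecomposable
  modules in semistable pairs are isomorphic.  Direct summands of a module in a semistable pair form
  semistable pairs again, so all dimension vectors of modules in semistable pairs at \<open>t\<close> are proportional.
  Thus the inequalities defining \<open>D(M)\<close> are either strict at \<open>\<gamma>(t)\<close> or hold on all of \<open>H(M)\<close>, and since
  there are only finitely many of them, \<open>D(M)\<close> is a neighbourhood of \<open>\<gamma>(t)\<close> in \<open>H(M)\<close>.
\<close>

section \<open>Submodules and epimorphisms\<close>

text \<open>\<open>dimension_vector\<close> picks a composition series by \<open>SOME\<close>, so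
  even its additivity on direct sums rests on the Jordan-Hoelder theorem. That theorem is proved for
  right modules over any ring that carry a strictly monotone rank on submodules; finite dimension
  over \<open>K\<close> supplies the rank. Two obstacles shape the rest. Factor modules have sets as
  elements, whereas \<open>S_complete\<close> speaks about modules on
  \<open>nat \<Rightarrow> 'k\<close>; comparisons therefore go through epimorphisms and their
  kernels, and a factor is copied back when a simple module has to be named. The cone
  \<open>D\<close> tests all submodules, possibly infinitely many, but their dimension vectors lie
  in a finite box. The signs of the path at both ends come from the two coefficient vectors being
  eventually constant.\<close>

context right_module
begin

lemma act_zero: "a \<in> carrier \<Lambda> \<Longrightarrow> a \<odot>\<^bsub>M\<^esub> \<zero>\<^bsub>M\<^esub> = \<zero>\<^bsub>M\<^esub>"
  using act_add[of a "\<zero>\<^bsub>M\<^esub>" "\<zero>\<^bsub>M\<^esub>"] act_closed[of a "\<zero>\<^bsub>M\<^esub>"]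
  by (metis M.add.l_cancel_one' M.zero_closed)

lemma zero_act: "x \<in> carrier M \<Longrightarrow> \<zero>\<^bsub>\<Lambda>\<^esub> \<odot>\<^bsub>M\<^esub> x = \<zero>\<^bsub>M\<^esub>"
  using act_add_scalar[of "\<zero>\<^bsub>\<Lambda>\<^esub>" "\<zero>\<^bsub>\<Lambda>\<^esub>" x] act_closed[of "\<zero>\<^bsub>\<Lambda>\<^esub>" x]
  by (metis M.add.l_cancel_one' R.zero_closed R.l_zero)

lemma minus_one_act: "x \<in> carrier M \<Longrightarrow> (\<ominus>\<^bsub>\<Lambda>\<^esub> \<one>\<^bsub>\<Lambda>\<^esub>) \<odot>\<^bsub>M\<^esub> x = \<ominus>\<^bsub>M\<^esub> x"
  using act_add_scalar[of "\<ominus>\<^bsub>\<Lambda>\<^esub> \<one>\<^bsub>\<Lambda>\<^esub>" "\<one>\<^bsub>\<Lambda>\<^esub>" x] zero_act[of x] act_one[of x]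
  by (metis M.minus_equality R.a_inv_closed R.l_neg R.one_closed act_closed)

text \<open>Negation is the action of -1, so the closure under inverses that
  \<open>submodule\<close> inherits from subgroups follows from closure under scalars.\<close>

lemma submodule_iff:
  "submodule N \<Lambda> M \<longleftrightarrow> N \<subseteq> carrier M \<and> \<zero>\<^bsub>M\<^esub> \<in> N \<and> (\<forall>x\<in>N. \<forall>y\<in>N. x \<oplus>\<^bsub>M\<^esub> y \<in> N) \<and>
     (\<forall>a\<in>carrier \<Lambda>. \<forall>x\<in>N. a \<odot>\<^bsub>M\<^esub> x \<in> N)" (is "_ \<longleftrightarrow> ?R")
proof
  assume "submodule N \<Lambda> M"
  then interpret submodule N \<Lambda> M .
  show ?R using subset one_closed m_closed smult_closed by auto
next
  assume R: ?R
  have "\<ominus>\<^bsub>M\<^esub> x \<in> N" if "x \<in> N" for x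
    using R that minus_one_act[of x] R.a_inv_closed[OF R.one_closed] by (metis subsetD)
  with R show "submodule N \<Lambda> M"
    by (intro submodule.intro subgroup.intro) (auto simp: submodule_axioms_def a_inv_def[symmetric])
qed

lemma submoduleD:
  assumes "submodule N \<Lambda> M"
  shows "N \<subseteq> carrier M" "\<zero>\<^bsub>M\<^esub> \<in> N" "\<And>x y. \<lbrakk>x \<in> N; y \<in> N\<rbrakk> \<Longrightarrow> x \<oplus>\<^bsub>M\<^esub> y \<in> N"
    "\<And>a x. \<lbrakk>a \<in> carrier \<Lambda>; x \<in> N\<rbrakk> \<Longrightarrow> a \<odot>\<^bsub>M\<^esub> x \<in> N"
    "\<And>x. x \<in> N \<Longrightarrow> \<ominus>\<^bsub>M\<^esub> x \<in> N"
proof -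
  show *: "N \<subseteq> carrier M" "\<zero>\<^bsub>M\<^esub> \<in> N" "\<And>x y. \<lbrakk>x \<in> N; y \<in> N\<rbrakk> \<Longrightarrow> x \<oplus>\<^bsub>M\<^esub> y \<in> N"
    "\<And>a x. \<lbrakk>a \<in> carrier \<Lambda>; x \<in> N\<rbrakk> \<Longrightarrow> a \<odot>\<^bsub>M\<^esub> x \<in> N"
    using assms by (auto simp: submodule_iff)
  show "\<ominus>\<^bsub>M\<^esub> x \<in> N" if "x \<in> N" for x
    using * that minus_one_act[of x] R.a_inv_closed[OF R.one_closed] by (metis subsetD)
qed

lemma zero_submodule: "submodule {\<zero>\<^bsub>M\<^esub>} \<Lambda> M"
  by (auto simp: submodule_iff act_zero)

lemma carrier_submodule: "submodule (carrier M) \<Lambda> M"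
  by (auto simp: submodule_iff act_closed)

lemma Int_submodule: "submodule A \<Lambda> M \<Longrightarrow> submodule B \<Lambda> M \<Longrightarrow> submodule (A \<inter> B) \<Lambda> M"
  by (auto simp: submodule_iff)

lemma sum_submodule:
  assumes A: "submodule A \<Lambda> M" and B: "submodule B \<Lambda> M"
  shows "submodule (A <+>\<^bsub>M\<^esub> B) \<Lambda> M"
proof -
  note * = submoduleD[OF A] submoduleD[OF B]
  have [simp]: "x \<in> carrier M" if "x \<in> A \<or> x \<in> B" for x using that * by auto
  have "\<exists>a\<in>A. \<exists>b\<in>B. (a1 \<oplus>\<^bsub>M\<^esub> b1) \<oplus>\<^bsub>M\<^esub> (a2 \<oplus>\<^bsub>M\<^esub> b2) = a \<oplus>\<^bsub>M\<^esub> b"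
    if "a1 \<in> A" "a2 \<in> A" "b1 \<in> B" "b2 \<in> B" for a1 a2 b1 b2
    using that * by (intro bexI[of _ "a1 \<oplus>\<^bsub>M\<^esub> a2"] bexI[of _ "b1 \<oplus>\<^bsub>M\<^esub> b2"]) (auto simp: M.a_ac)
  moreover have "\<exists>x\<in>A. \<exists>y\<in>B. c \<odot>\<^bsub>M\<^esub> (a \<oplus>\<^bsub>M\<^esub> b) = x \<oplus>\<^bsub>M\<^esub> y"
    if "a \<in> A" "b \<in> B" "c \<in> carrier \<Lambda>" for a b c
    using that * by (intro bexI[of _ "c \<odot>\<^bsub>M\<^esub> a"] bexI[of _ "c \<odot>\<^bsub>M\<^esub> b"]) (auto simp: act_add)
  moreover have "\<exists>x\<in>A. \<exists>y\<in>B. \<zero>\<^bsub>M\<^esub> = x \<oplus>\<^bsub>M\<^esub> y"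
    using * by (intro bexI[of _ "\<zero>\<^bsub>M\<^esub>"]) auto
  ultimately show ?thesis
    using * unfolding submodule_iff set_add_def' by auto
qed

lemma subset_sum:
  assumes A: "submodule A \<Lambda> M" and B: "submodule B \<Lambda> M"
  shows "A \<subseteq> A <+>\<^bsub>M\<^esub> B" "B \<subseteq> A <+>\<^bsub>M\<^esub> B"
proof -
  note * = submoduleD[OF A] submoduleD[OF B]
  have "\<exists>a\<in>A. \<exists>b\<in>B. x = a \<oplus>\<^bsub>M\<^esub> b" if "x \<in> A" for x
    using that * by (intro bexI[of _ x] bexI[of _ "\<zero>\<^bsub>M\<^esub>"]) auto
  then show "A \<subseteq> A <+>\<^bsub>M\<^esub> B" by (auto simp: set_add_def')
  have "\<exists>a\<in>A. \<exists>b\<in>B. x = a \<oplus>\<^bsub>M\<^esub> b" if "x \<in> B" for x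
    using that * by (intro bexI[of _ "\<zero>\<^bsub>M\<^esub>"] bexI[of _ x]) auto
  then show "B \<subseteq> A <+>\<^bsub>M\<^esub> B" by (auto simp: set_add_def')
qed

lemma submodule_right_module:
  assumes N: "submodule N \<Lambda> M"
  shows "right_module \<Lambda> (M\<lparr>carrier := N\<rparr>)"
proof -
  note * = submoduleD[OF N]
  have [simp]: "x \<in> N \<Longrightarrow> x \<in> carrier M" for x using * by auto
  have "abelian_group (M\<lparr>carrier := N\<rparr>)"
  proof (rule abelian_groupI)
    show "\<exists>y\<in>carrier (M\<lparr>carrier := N\<rparr>). y \<oplus>\<^bsub>M\<lparr>carrier := N\<rparr>\<^esub> x = \<zero>\<^bsub>M\<lparr>carrier := N\<rparr>\<^esub>"
      if "x \<in> carrier (M\<lparr>carrier := N\<rparr>)" for x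
      using that * by (intro bexI[of _ "\<ominus>\<^bsub>M\<^esub> x"]) (auto simp: M.l_neg)
  qed (use * in \<open>auto simp: M.a_ac\<close>)
  then show ?thesis
    using * R.ring_axioms
    by (intro right_module.intro right_module_axioms.intro)
      (auto simp: act_add act_add_scalar act_mult act_one)
qed

lemma submodule_restrict_iff:
  assumes N: "submodule N \<Lambda> M"
  shows "submodule L \<Lambda> (M\<lparr>carrier := N\<rparr>) \<longleftrightarrow> submodule L \<Lambda> M \<and> L \<subseteq> N"
  using right_module.submodule_iff[OF submodule_right_module[OF N], of L] submoduleD(1)[OF N]
  by (auto simp: submodule_iff)

end

text \<open>No structure on \<open>T\<close> is presupposed, which is why preservation of zero is
  listed separately: the target inherits the module axioms from the source along such a map.
  Quotients and transported structures become modules in this way, and isomorphisms are handled as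
  epimorphisms with zero kernel.\<close>

definition module_epi ::
    "('a, 'r) ring_scheme \<Rightarrow> ('a, 'm) module \<Rightarrow> ('a, 'l) module \<Rightarrow> ('m \<Rightarrow> 'l) \<Rightarrow> bool" where
  "module_epi \<Lambda> M T f \<longleftrightarrow> f ` carrier M = carrier T \<and> f \<zero>\<^bsub>M\<^esub> = \<zero>\<^bsub>T\<^esub> \<and>
     (\<forall>x\<in>carrier M. \<forall>y\<in>carrier M. f (x \<oplus>\<^bsub>M\<^esub> y) = f x \<oplus>\<^bsub>T\<^esub> f y) \<and>
     (\<forall>a\<in>carrier \<Lambda>. \<forall>x\<in>carrier M. f (a \<odot>\<^bsub>M\<^esub> x) = a \<odot>\<^bsub>T\<^esub> f x)"

lemma module_epi_comp:
  assumes "module_epi \<Lambda> M T f" "module_epi \<Lambda> T U g"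
  shows "module_epi \<Lambda> M U (g \<circ> f)"
proof -
  have "f x \<in> carrier T" if "x \<in> carrier M" for x
    using assms that by (auto simp: module_epi_def)
  with assms show ?thesis
    by (simp add: module_epi_def flip: image_image)
qed

context right_module
begin

lemma epi_right_module:
  assumes f: "module_epi \<Lambda> M T f"
  shows "right_module \<Lambda> T"
proof -
  have c: "carrier T = f ` carrier M" and z: "\<zero>\<^bsub>T\<^esub> = f \<zero>\<^bsub>M\<^esub>"
    and a: "\<And>x y. \<lbrakk>x \<in> carrier M; y \<in> carrier M\<rbrakk> \<Longrightarrow> f x \<oplus>\<^bsub>T\<^esub> f y = f (x \<oplus>\<^bsub>M\<^esub> y)"
    and s: "\<And>a x. \<lbrakk>a \<in> carrier \<Lambda>; x \<in> carrier M\<rbrakk> \<Longrightarrow> a \<odot>\<^bsub>T\<^esub> f x = f (a \<odot>\<^bsub>M\<^esub> x)"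
    using f by (auto simp: module_epi_def)
  have "abelian_group T"
  proof (rule abelian_groupI)
    show "\<exists>y\<in>carrier T. y \<oplus>\<^bsub>T\<^esub> x = \<zero>\<^bsub>T\<^esub>" if "x \<in> carrier T" for x
      using that by (auto simp: c z a M.l_neg intro!: bexI[of _ "\<ominus>\<^bsub>M\<^esub> _"])
  qed (auto simp: c z a M.a_ac)
  then show ?thesis
    using R.ring_axioms
    by (intro right_module.intro right_module_axioms.intro)
      (auto simp: c a s act_add act_add_scalar act_mult act_one act_closed)
qed

lemma epi_eq_iff:
  assumes f: "module_epi \<Lambda> M T f" and x: "x \<in> carrier M" and y: "y \<in> carrier M"
  shows "f x = f y \<longleftrightarrow> f (x \<ominus>\<^bsub>M\<^esub> y) = \<zero>\<^bsub>T\<^esub>"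
proof -
  interpret T: right_module \<Lambda> T by (rule epi_right_module[OF f])
  have a: "\<And>x y. \<lbrakk>x \<in> carrier M; y \<in> carrier M\<rbrakk> \<Longrightarrow> f (x \<oplus>\<^bsub>M\<^esub> y) = f x \<oplus>\<^bsub>T\<^esub> f y"
    and c: "\<And>x. x \<in> carrier M \<Longrightarrow> f x \<in> carrier T"
    using f by (auto simp: module_epi_def)
  have "f x = f (x \<ominus>\<^bsub>M\<^esub> y) \<oplus>\<^bsub>T\<^esub> f y"
    using x y by (simp add: a[symmetric] a_minus_def M.a_assoc M.l_neg)
  then show ?thesis
    using x y c by (metis T.M.add.r_cancel_one' M.minus_closed)
qed

text \<open>Both targets are \<open>M\<close> modulo the same kernel. The fibres of \<open>f\<close>
  and of \<open>g\<close> are the cosets of this kernel, so sending \<open>f x\<close> to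
  \<open>g x\<close> is well defined and injective; \<open>h\<close> realises this through an
  arbitrary preimage.\<close>

lemma isomorphic_of_epis:
  assumes f: "module_epi \<Lambda> M T f" and g: "module_epi \<Lambda> M U g"
    and ker: "\<And>x. x \<in> carrier M \<Longrightarrow> f x = \<zero>\<^bsub>T\<^esub> \<longleftrightarrow> g x = \<zero>\<^bsub>U\<^esub>"
  shows "isomorphic_modules \<Lambda> T U"
proof -
  define h where "h = (\<lambda>t. g (inv_into (carrier M) f t))"
  have eq: "f x = f y \<longleftrightarrow> g x = g y" if "x \<in> carrier M" "y \<in> carrier M" for x y
    using that epi_eq_iff[OF f] epi_eq_iff[OF g] ker by simp
  have hf: "h (f x) = g x" if "x \<in> carrier M" for x
    unfolding h_def using that eq by (metis f_inv_into_f imageI inv_into_into)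
  have c: "carrier T = f ` carrier M" "carrier U = g ` carrier M"
    and a: "\<And>x y. \<lbrakk>x \<in> carrier M; y \<in> carrier M\<rbrakk> \<Longrightarrow> f x \<oplus>\<^bsub>T\<^esub> f y = f (x \<oplus>\<^bsub>M\<^esub> y)"
      "\<And>x y. \<lbrakk>x \<in> carrier M; y \<in> carrier M\<rbrakk> \<Longrightarrow> g x \<oplus>\<^bsub>U\<^esub> g y = g (x \<oplus>\<^bsub>M\<^esub> y)"
    and s: "\<And>a x. \<lbrakk>a \<in> carrier \<Lambda>; x \<in> carrier M\<rbrakk> \<Longrightarrow> a \<odot>\<^bsub>T\<^esub> f x = f (a \<odot>\<^bsub>M\<^esub> x)"
      "\<And>a x. \<lbrakk>a \<in> carrier \<Lambda>; x \<in> carrier M\<rbrakk> \<Longrightarrow> a \<odot>\<^bsub>U\<^esub> g x = g (a \<odot>\<^bsub>M\<^esub> x)"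
    using f g by (auto simp: module_epi_def)
  have "h \<in> iso (add_monoid T) (add_monoid U)"
    by (rule isoI, rule homI) (auto simp: c hf a eq bij_betw_def inj_on_def image_image)
  then show ?thesis
    unfolding isomorphic_modules_def by (rule bexI[rotated]) (auto simp: c s hf act_closed)
qed

lemma epi_id: "module_epi \<Lambda> M M (\<lambda>x. x)"
  by (simp add: module_epi_def)

lemma isomorphic_imp_epi:
  assumes T: "right_module \<Lambda> T" and iso: "isomorphic_modules \<Lambda> M T"
  obtains f where "module_epi \<Lambda> M T f" "\<And>x. x \<in> carrier M \<Longrightarrow> f x = \<zero>\<^bsub>T\<^esub> \<longleftrightarrow> x = \<zero>\<^bsub>M\<^esub>"
proof -
  interpret T: right_module \<Lambda> T by (rule T)
  obtain f where f: "f \<in> iso (add_monoid M) (add_monoid T)"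
    "\<And>a x. a \<in> carrier \<Lambda> \<Longrightarrow> x \<in> carrier M \<Longrightarrow> f (a \<odot>\<^bsub>M\<^esub> x) = a \<odot>\<^bsub>T\<^esub> f x"
    using iso by (auto simp: isomorphic_modules_def)
  have z: "f \<zero>\<^bsub>M\<^esub> = \<zero>\<^bsub>T\<^esub>"
    using hom_one[of f "add_monoid M" "add_monoid T"] f(1) M.add.is_group T.M.add.is_group
    by (simp add: iso_def)
  have "module_epi \<Lambda> M T f"
    using f z by (auto simp: module_epi_def iso_def bij_betw_def hom_def)
  moreover have "inj_on f (carrier M)"
    using f by (auto simp: iso_def bij_betw_def)
  ultimately show thesis
    using z that[of f] by (metis M.zero_closed inj_onD)
qed

lemma epi_isomorphic:
  assumes "module_epi \<Lambda> M T f" "\<And>x. x \<in> carrier M \<Longrightarrow> f x = \<zero>\<^bsub>T\<^esub> \<longleftrightarrow> x = \<zero>\<^bsub>M\<^esub>"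
  shows "isomorphic_modules \<Lambda> M T" "isomorphic_modules \<Lambda> T M"
  using isomorphic_of_epis[OF epi_id assms(1)] isomorphic_of_epis[OF assms(1) epi_id] assms(2) by auto

lemma isomorphic_sym:
  assumes "right_module \<Lambda> T" "isomorphic_modules \<Lambda> M T"
  shows "isomorphic_modules \<Lambda> T M"
proof -
  obtain f where "module_epi \<Lambda> M T f" "\<And>x. x \<in> carrier M \<Longrightarrow> f x = \<zero>\<^bsub>T\<^esub> \<longleftrightarrow> x = \<zero>\<^bsub>M\<^esub>"
    by (rule isomorphic_imp_epi[OF assms]) (rule that)
  then show ?thesis by (rule epi_isomorphic(2))
qed

end

lemma isomorphic_modules_trans:
  assumes "isomorphic_modules \<Lambda> M T" "isomorphic_modules \<Lambda> T U"
  shows "isomorphic_modules \<Lambda> M U"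
proof -
  obtain f g where f: "f \<in> iso (add_monoid M) (add_monoid T)"
    and g: "g \<in> iso (add_monoid T) (add_monoid U)"
    and fs: "\<And>a x. a \<in> carrier \<Lambda> \<Longrightarrow> x \<in> carrier M \<Longrightarrow> f (a \<odot>\<^bsub>M\<^esub> x) = a \<odot>\<^bsub>T\<^esub> f x"
    and gs: "\<And>a x. a \<in> carrier \<Lambda> \<Longrightarrow> x \<in> carrier T \<Longrightarrow> g (a \<odot>\<^bsub>T\<^esub> x) = a \<odot>\<^bsub>U\<^esub> g x"
    using assms by (auto simp: isomorphic_modules_def)
  have c: "f x \<in> carrier T" if "x \<in> carrier M" for x
    using f that by (auto simp: iso_def hom_def)
  have "g \<circ> f \<in> iso (add_monoid M) (add_monoid U)"
    using f g by (auto simp: iso_def hom_def Pi_iff intro: bij_betw_trans)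
  then show ?thesis
    unfolding isomorphic_modules_def by (rule bexI[rotated]) (simp add: fs gs c)
qed

context right_module
begin

lemma epi_image_submodule:
  assumes f: "module_epi \<Lambda> M T f" and C: "submodule C \<Lambda> M"
  shows "submodule (f ` C) \<Lambda> T"
proof -
  interpret T: right_module \<Lambda> T by (rule epi_right_module[OF f])
  show ?thesis
    unfolding T.submodule_iff
  proof (intro conjI ballI)
    show "f ` C \<subseteq> carrier T" "\<zero>\<^bsub>T\<^esub> \<in> f ` C"
      using f submoduleD(1,2)[OF C] by (auto simp: module_epi_def) (metis imageI)
    show "x \<oplus>\<^bsub>T\<^esub> y \<in> f ` C" if xy: "x \<in> f ` C" "y \<in> f ` C" for x y
    proof -
      obtain c d where cd: "c \<in> C" "d \<in> C" "x = f c" "y = f d" using xy by blast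
      then have "x \<oplus>\<^bsub>T\<^esub> y = f (c \<oplus>\<^bsub>M\<^esub> d)"
        using f submoduleD(1)[OF C] by (simp add: module_epi_def subset_iff)
      then show ?thesis using submoduleD(3)[OF C] cd by blast
    qed
    show "a \<odot>\<^bsub>T\<^esub> x \<in> f ` C" if ax: "a \<in> carrier \<Lambda>" "x \<in> f ` C" for a x
    proof -
      obtain c where c: "c \<in> C" "x = f c" using ax by blast
      then have "a \<odot>\<^bsub>T\<^esub> x = f (a \<odot>\<^bsub>M\<^esub> c)"
        using f submoduleD(1)[OF C] ax by (simp add: module_epi_def subset_iff)
      then show ?thesis using submoduleD(4)[OF C] ax c by blast
    qed
  qed
qed

lemma epi_vimage_submodule:
  assumes f: "module_epi \<Lambda> M T f" and U: "submodule U \<Lambda> T"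
  shows "submodule {x \<in> carrier M. f x \<in> U} \<Lambda> M"
proof -
  interpret T: right_module \<Lambda> T by (rule epi_right_module[OF f])
  show ?thesis
    using f T.submoduleD[OF U] unfolding submodule_iff module_epi_def
    by (auto simp: act_closed)
qed

text \<open>Correspondence theorem: images and preimages match the submodules of \<open>T\<close>
  with the submodules of \<open>M\<close> that contain the kernel \<open>k\<close>. Simplicity of a
  quotient thus becomes maximality of \<open>k\<close> inside \<open>M\<close>.\<close>

lemma simple_epi_iff:
  assumes f: "module_epi \<Lambda> M T f" and k: "k = {x \<in> carrier M. f x = \<zero>\<^bsub>T\<^esub>}"
  shows "simple_module \<Lambda> T \<longleftrightarrow>
    k \<noteq> carrier M \<and> (\<forall>C. submodule C \<Lambda> M \<and> k \<subseteq> C \<longrightarrow> C = k \<or> C = carrier M)"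
    (is "_ \<longleftrightarrow> ?R")
proof -
  interpret T: right_module \<Lambda> T by (rule epi_right_module[OF f])
  have im: "carrier T = f ` carrier M" and z: "f \<zero>\<^bsub>M\<^esub> = \<zero>\<^bsub>T\<^esub>"
    and a: "\<And>x y. \<lbrakk>x \<in> carrier M; y \<in> carrier M\<rbrakk> \<Longrightarrow> f (x \<oplus>\<^bsub>M\<^esub> y) = f x \<oplus>\<^bsub>T\<^esub> f y"
    using f by (auto simp: module_epi_def)
  have nz: "nonzero_module T \<longleftrightarrow> k \<noteq> carrier M"
  proof -
    have "carrier T = {\<zero>\<^bsub>T\<^esub>} \<longleftrightarrow> (\<forall>x\<in>carrier M. f x = \<zero>\<^bsub>T\<^esub>)"
    proof -
      have "carrier T = {\<zero>\<^bsub>T\<^esub>} \<longleftrightarrow> f ` carrier M \<subseteq> {\<zero>\<^bsub>T\<^esub>}"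
        using im T.M.zero_closed by blast
      then show ?thesis by auto
    qed
    then show ?thesis by (auto simp: nonzero_module_def k)
  qed
  have 1: "C = k \<or> C = carrier M"
    if C0: "submodule C \<Lambda> M" and kC: "k \<subseteq> C" and "f ` C = {\<zero>\<^bsub>T\<^esub>} \<or> f ` C = carrier T" for C
    using that(3)
  proof
    assume "f ` C = {\<zero>\<^bsub>T\<^esub>}"
    then show ?thesis using kC submoduleD(1)[OF C0] by (auto simp: k)
  next
    assume C: "f ` C = carrier T"
    \<comment> \<open>Some \<open>c\<close> in \<open>C\<close> has the same image as
      \<open>x\<close>; the difference lies in the kernel, hence in \<open>C\<close>, and adding
      \<open>c\<close> back gives \<open>x\<close>.\<close>
    have "x \<in> C" if x: "x \<in> carrier M" for x
    proof -
      obtain c where c: "c \<in> C" "f x = f c" using C x im by (metis imageE imageI)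
      then have cM: "c \<in> carrier M" using submoduleD(1)[OF C0] by blast
      have "x \<ominus>\<^bsub>M\<^esub> c \<in> C" using epi_eq_iff[OF f x cM] c kC x cM by (auto simp: k)
      then have "(x \<ominus>\<^bsub>M\<^esub> c) \<oplus>\<^bsub>M\<^esub> c \<in> C" using c submoduleD(3)[OF C0] by blast
      then show ?thesis using x cM by (simp add: a_minus_def M.a_assoc M.l_neg)
    qed
    then show ?thesis using submoduleD(1)[OF C0] by blast
  qed
  show ?thesis
  proof
    assume T: "simple_module \<Lambda> T"
    show ?R
    proof (intro conjI allI impI)
      show "k \<noteq> carrier M" using T nz by (simp add: simple_module_def)
      show "C = k \<or> C = carrier M" if "submodule C \<Lambda> M \<and> k \<subseteq> C" for C
        using T epi_image_submodule[OF f, of C] 1[of C] that by (simp add: simple_module_def)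
    qed
  next
    assume R: ?R
    have "U = {\<zero>\<^bsub>T\<^esub>} \<or> U = carrier T" if U: "submodule U \<Lambda> T" for U
    proof -
      let ?C = "{x \<in> carrier M. f x \<in> U}"
      have "k \<subseteq> ?C" using T.submoduleD(2)[OF U] by (auto simp: k)
      then have C: "?C = k \<or> ?C = carrier M" using R epi_vimage_submodule[OF f U] by blast
      have "U = f ` ?C" using T.submoduleD(1)[OF U] im by auto
      moreover have "f ` k = {\<zero>\<^bsub>T\<^esub>}" using z by (auto simp: k)
      ultimately show ?thesis using C im by (elim disjE) simp_all
    qed
    then show "simple_module \<Lambda> T" using R by (simp add: simple_module_def nz)
  qed
qed

lemma simple_module_iff:
  "simple_module \<Lambda> M \<longleftrightarrow> {\<zero>\<^bsub>M\<^esub>} \<noteq> carrier M \<and>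
     (\<forall>C. submodule C \<Lambda> M \<longrightarrow> C = {\<zero>\<^bsub>M\<^esub>} \<or> C = carrier M)"
  by (auto simp: simple_module_def nonzero_module_def)

lemma isomorphic_simple:
  assumes T: "right_module \<Lambda> T" and iso: "isomorphic_modules \<Lambda> M T" and M: "simple_module \<Lambda> M"
  shows "simple_module \<Lambda> T"
proof -
  obtain f where f: "module_epi \<Lambda> M T f" "\<And>x. x \<in> carrier M \<Longrightarrow> f x = \<zero>\<^bsub>T\<^esub> \<longleftrightarrow> x = \<zero>\<^bsub>M\<^esub>"
    by (rule isomorphic_imp_epi[OF T iso]) (rule that)
  then have k: "{\<zero>\<^bsub>M\<^esub>} = {x \<in> carrier M. f x = \<zero>\<^bsub>T\<^esub>}" by auto
  show ?thesis
    using M unfolding simple_epi_iff[OF f(1) k] simple_module_iff by blast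
qed

section \<open>Factor modules and the second isomorphism theorem\<close>

lemma quotient_epi:
  assumes N: "submodule N \<Lambda> M"
  shows "module_epi \<Lambda> M (quotient_module M N) (\<lambda>x. N +>\<^bsub>M\<^esub> x)"
    and "x \<in> carrier M \<Longrightarrow> N +>\<^bsub>M\<^esub> x = N \<longleftrightarrow> x \<in> N"
proof -
  note * = submoduleD[OF N]
  have sub: "subgroup N (add_monoid M)" using N by (simp add: submodule_def)
  then interpret N: abelian_subgroup N M by (intro abelian_subgroupI3 additive_subgroupI M.abelian_group_axioms)
  \<comment> \<open>The action on a coset is defined as a union over its representatives. Replacing
    \<open>x\<close> by \<open>n + x\<close> with \<open>n\<close> in \<open>N\<close> changes the
    result by the action of \<open>a\<close> on \<open>n\<close>, which stays in \<open>N\<close>,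
    so all members of the union coincide.\<close>
  have act: "(\<Union>y\<in>N +>\<^bsub>M\<^esub> x. N +>\<^bsub>M\<^esub> (a \<odot>\<^bsub>M\<^esub> y)) = N +>\<^bsub>M\<^esub> (a \<odot>\<^bsub>M\<^esub> x)"
    if a: "a \<in> carrier \<Lambda>" and x: "x \<in> carrier M" for a x
  proof -
    have "N +>\<^bsub>M\<^esub> (a \<odot>\<^bsub>M\<^esub> y) = N +>\<^bsub>M\<^esub> (a \<odot>\<^bsub>M\<^esub> x)" if "y \<in> N +>\<^bsub>M\<^esub> x" for y
    proof -
      obtain n where n: "n \<in> N" "y = n \<oplus>\<^bsub>M\<^esub> x" using \<open>y \<in> N +>\<^bsub>M\<^esub> x\<close> unfolding a_r_coset_def' by blast
      then have "n \<in> carrier M" using * by auto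
      then have "N +>\<^bsub>M\<^esub> (a \<odot>\<^bsub>M\<^esub> y) = (N +>\<^bsub>M\<^esub> (a \<odot>\<^bsub>M\<^esub> n)) +>\<^bsub>M\<^esub> (a \<odot>\<^bsub>M\<^esub> x)"
        using n a x * by (simp add: act_add M.a_coset_add_assoc act_closed)
      also have "N +>\<^bsub>M\<^esub> (a \<odot>\<^bsub>M\<^esub> n) = N" using n a * by (intro N.a_rcos_const) auto
      finally show ?thesis .
    qed
    then show ?thesis using N.a_rcos_self[OF x] by blast
  qed
  show "module_epi \<Lambda> M (quotient_module M N) (\<lambda>x. N +>\<^bsub>M\<^esub> x)"
    using act N.a_rcos_sum N.a_rcos_const[of "\<zero>\<^bsub>M\<^esub>"] *
    unfolding module_epi_def quotient_module_def by (auto simp: A_RCOSETS_def' act_closed)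
  show "N +>\<^bsub>M\<^esub> x = N \<longleftrightarrow> x \<in> N" if "x \<in> carrier M"
    using N.a_rcos_self[OF that] N.a_rcos_const by blast
qed

text \<open>Later arguments see a factor module through a projection with prescribed kernel; its
  cosets matter again only when it is copied to another carrier type.\<close>

lemma factor_epi:
  assumes A: "submodule A \<Lambda> M" and X: "submodule X \<Lambda> M" and "A \<subseteq> X"
  obtains p where "module_epi \<Lambda> (M\<lparr>carrier := X\<rparr>) (factor_module M X A) p"
    "\<And>x. x \<in> X \<Longrightarrow> p x = \<zero>\<^bsub>factor_module M X A\<^esub> \<longleftrightarrow> x \<in> A"
proof -
  interpret X: right_module \<Lambda> "M\<lparr>carrier := X\<rparr>" by (rule submodule_right_module[OF X])
  have "submodule A \<Lambda> (M\<lparr>carrier := X\<rparr>)" using assms by (simp add: submodule_restrict_iff)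
  from X.quotient_epi[OF this] show thesis
    by (intro that) (simp_all add: factor_module_def, simp add: quotient_module_def)
qed

lemma factor_right_module:
  assumes "submodule A \<Lambda> M" "submodule X \<Lambda> M" "A \<subseteq> X"
  shows "right_module \<Lambda> (factor_module M X A)"
  by (rule factor_epi[OF assms])
    (rule right_module.epi_right_module[OF submodule_right_module[OF assms(2)]])

lemma simple_factor_iff:
  assumes A: "submodule A \<Lambda> M" and X: "submodule X \<Lambda> M" and AX: "A \<subseteq> X"
  shows "simple_module \<Lambda> (factor_module M X A) \<longleftrightarrow>
    A \<noteq> X \<and> (\<forall>C. submodule C \<Lambda> M \<and> A \<subseteq> C \<and> C \<subseteq> X \<longrightarrow> C = A \<or> C = X)"
proof -
  interpret X: right_module \<Lambda> "M\<lparr>carrier := X\<rparr>" by (rule submodule_right_module[OF X])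
  obtain p where p: "module_epi \<Lambda> (M\<lparr>carrier := X\<rparr>) (factor_module M X A) p"
    "\<And>x. x \<in> X \<Longrightarrow> p x = \<zero>\<^bsub>factor_module M X A\<^esub> \<longleftrightarrow> x \<in> A"
    by (rule factor_epi[OF assms]) (rule that)
  have "A = {x \<in> carrier (M\<lparr>carrier := X\<rparr>). p x = \<zero>\<^bsub>factor_module M X A\<^esub>}"
    using p(2) AX by auto
  from X.simple_epi_iff[OF p(1) this] show ?thesis
    by (simp add: submodule_restrict_iff[OF X]) blast
qed

lemma isomorphic_factor:
  assumes A: "submodule A \<Lambda> M" and X: "submodule X \<Lambda> M" and AX: "A \<subseteq> X"
    and g: "module_epi \<Lambda> (M\<lparr>carrier := X\<rparr>) U g" "\<And>x. x \<in> X \<Longrightarrow> g x = \<zero>\<^bsub>U\<^esub> \<longleftrightarrow> x \<in> A"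
  shows "isomorphic_modules \<Lambda> (factor_module M X A) U"
proof -
  interpret X: right_module \<Lambda> "M\<lparr>carrier := X\<rparr>" by (rule submodule_right_module[OF X])
  obtain p where p: "module_epi \<Lambda> (M\<lparr>carrier := X\<rparr>) (factor_module M X A) p"
    "\<And>x. x \<in> X \<Longrightarrow> p x = \<zero>\<^bsub>factor_module M X A\<^esub> \<longleftrightarrow> x \<in> A"
    by (rule factor_epi[OF A X AX]) (rule that)
  show ?thesis
    by (rule X.isomorphic_of_epis[OF p(1) g(1)]) (simp add: p g)
qed

text \<open>The projection of \<open>A + B\<close> modulo \<open>A\<close> is restricted to
  \<open>B\<close>. It stays surjective because the summand from \<open>A\<close> is killed, and its
  kernel becomes \<open>A \<inter> B\<close>.\<close>

lemma second_isomorphism: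
  assumes A: "submodule A \<Lambda> M" and B: "submodule B \<Lambda> M"
  shows "isomorphic_modules \<Lambda> (factor_module M B (A \<inter> B)) (factor_module M (A <+>\<^bsub>M\<^esub> B) A)"
proof -
  let ?X = "A <+>\<^bsub>M\<^esub> B"
  have X: "submodule ?X \<Lambda> M" by (rule sum_submodule[OF A B])
  note sub = subset_sum[OF A B]
  note T = factor_right_module[OF A X sub(1)]
  interpret T: right_module \<Lambda> "factor_module M ?X A" by (rule T)
  obtain p where p: "module_epi \<Lambda> (M\<lparr>carrier := ?X\<rparr>) (factor_module M ?X A) p"
    "\<And>x. x \<in> ?X \<Longrightarrow> p x = \<zero>\<^bsub>factor_module M ?X A\<^esub> \<longleftrightarrow> x \<in> A"
    by (rule factor_epi[OF A X sub(1)]) (rule that)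
  have pc: "p x \<in> carrier (factor_module M ?X A)" if "x \<in> ?X" for x
    using p(1) that by (auto simp: module_epi_def)
  have "p ` ?X = p ` B"
  proof -
    have "p x \<in> p ` B" if x: "x \<in> ?X" for x
    proof -
      obtain a b where ab: "a \<in> A" "b \<in> B" "x = a \<oplus>\<^bsub>M\<^esub> b" using x by (auto simp: set_add_def')
      then have "p x = p a \<oplus>\<^bsub>factor_module M ?X A\<^esub> p b"
        using p(1) sub by (simp add: module_epi_def subset_iff)
      also have "p a = \<zero>\<^bsub>factor_module M ?X A\<^esub>" using ab p(2) sub by auto
      finally have "p x = p b" using pc[of b] ab sub by auto
      then show ?thesis using ab by blast
    qed
    then show ?thesis using sub by blast
  qed
  then have e: "module_epi \<Lambda> (M\<lparr>carrier := B\<rparr>) (factor_module M ?X A) p"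
    using p(1) sub by (auto simp: module_epi_def subset_iff)
  show ?thesis
    by (rule isomorphic_factor[OF Int_submodule[OF A B] B Int_lower2 e]) (use p(2) sub in auto)
qed

end

section \<open>The Jordan--Hoelder theorem\<close>

text \<open>A composition series of a submodule \<open>X\<close>, reduced to its end and its
  multiplicities, inside one ambient module \<open>M\<close>. This is the form suited to induction:
  the list of submodules is forgotten, and series of different submodules are compared without
  changing the module.\<close>

inductive comp_factors ::
    "('a, 'r) ring_scheme \<Rightarrow> ('i \<Rightarrow> ('a, 'l) module) \<Rightarrow> ('a, 'm) module \<Rightarrow> 'm set \<Rightarrow> ('i \<Rightarrow> nat) \<Rightarrow> bool"
  for \<Lambda> S M where
  zero: "comp_factors \<Lambda> S M {\<zero>\<^bsub>M\<^esub>} (\<lambda>_. 0)"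
| step: "\<lbrakk>comp_factors \<Lambda> S M A v; submodule X \<Lambda> M; A \<subset> X; simple_module \<Lambda> (factor_module M X A)\<rbrakk> \<Longrightarrow>
    comp_factors \<Lambda> S M X (\<lambda>i. v i + of_bool (isomorphic_modules \<Lambda> (factor_module M X A) (S i)))"

text \<open>A rank on submodules instead of a bound on chain lengths: it gives directly submodules
  of least rank with a given property and a measure for well-founded induction.\<close>

definition finite_length :: "('a, 'r) ring_scheme \<Rightarrow> ('a, 'm) module \<Rightarrow> bool" where
  "finite_length \<Lambda> M \<longleftrightarrow> (\<exists>\<phi> :: 'm set \<Rightarrow> nat. \<forall>A B. submodule A \<Lambda> M \<longrightarrow> submodule B \<Lambda> M \<longrightarrow> A \<subset> B \<longrightarrow> \<phi> A < \<phi> B)"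

context right_module
begin

lemma comp_factors_submodule: "comp_factors \<Lambda> S M X v \<Longrightarrow> submodule X \<Lambda> M"
  by (induction rule: comp_factors.induct) (auto simp: zero_submodule)

text \<open>Among the submodules strictly above \<open>A\<close> and inside \<open>X\<close>, one of
  least rank, \<open>B\<close>, leaves nothing between \<open>A\<close> and itself, so
  \<open>B / A\<close> is simple; the construction goes on from \<open>B\<close>. The clause
  \<open>v \<le> w\<close> records that the series of \<open>A\<close> is kept, which later yields
  monotonicity of dimension vectors.\<close>

lemma comp_factors_extend:
  assumes fl: "finite_length \<Lambda> M"
    and "comp_factors \<Lambda> S M A v" "submodule X \<Lambda> M" "A \<subseteq> X"
  shows "\<exists>w. comp_factors \<Lambda> S M X w \<and> v \<le> w"
proof -
  obtain \<phi> :: "'m set \<Rightarrow> nat" where \<phi>: "\<And>A B. \<lbrakk>submodule A \<Lambda> M; submodule B \<Lambda> M; A \<subset> B\<rbrakk> \<Longrightarrow> \<phi> A < \<phi> B"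
    using fl unfolding finite_length_def by blast
  show ?thesis
    using assms(2-)
  proof (induction "\<phi> X - \<phi> A" arbitrary: A v rule: less_induct)
    case less
    note A = comp_factors_submodule[OF less.prems(1)]
    show ?case
    proof (cases "A = X")
      case False
      define P where "P B \<longleftrightarrow> submodule B \<Lambda> M \<and> A \<subset> B \<and> B \<subseteq> X" for B
      have "P X" using less.prems False by (auto simp: P_def)
      then obtain B where B: "P B" "\<And>C. P C \<Longrightarrow> \<phi> B \<le> \<phi> C"
        using ex_has_least_nat[of P X \<phi>] by auto
      have sB: "submodule B \<Lambda> M" and AB: "A \<subset> B" and BX: "B \<subseteq> X" using B(1) by (auto simp: P_def)
      have "C = A \<or> C = B" if "submodule C \<Lambda> M" "A \<subseteq> C" "C \<subseteq> B" for C
      proof (rule ccontr)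
        assume n: "\<not> (C = A \<or> C = B)"
        then have "P C" using that BX by (auto simp: P_def)
        then show False using B(2)[of C] \<phi>[OF that(1) sB] n that by auto
      qed
      then have "simple_module \<Lambda> (factor_module M B A)"
        using simple_factor_iff[OF A sB] AB by auto
      note st = comp_factors.step[OF less.prems(1) sB AB this]
      \<comment> \<open>The subtraction is truncated; it decreases because
        \<open>\<phi> A < \<phi> B \<le> \<phi> X\<close>, with equality on the right when
        \<open>B = X\<close>.\<close>
      have "\<phi> X - \<phi> B < \<phi> X - \<phi> A"
        using \<phi>[OF A sB AB] \<phi>[OF sB less.prems(2)] BX by (cases "B = X") (auto simp: psubset_eq)
      from less.hyps[OF this st less.prems(2) BX] show ?thesis
        by (auto simp: le_fun_def intro: add_leD1)
    qed (use less.prems in auto)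
  qed
qed

text \<open>If \<open>A\<close> and \<open>B\<close> are distinct maximal submodules of \<open>X\<close>, both series are compared with a
  series of \<open>A \<inter> B\<close>, since \<open>X / A \<cong> B / (A \<inter> B)\<close> and \<open>X / B \<cong> A / (A \<inter> B)\<close>.\<close>

lemma comp_factors_unique:
  assumes fl: "finite_length \<Lambda> M"
    and "comp_factors \<Lambda> S M X v" "comp_factors \<Lambda> S M X w"
  shows "v = w"
proof -
  obtain \<phi> :: "'m set \<Rightarrow> nat" where \<phi>: "\<And>A B. \<lbrakk>submodule A \<Lambda> M; submodule B \<Lambda> M; A \<subset> B\<rbrakk> \<Longrightarrow> \<phi> A < \<phi> B"
    using fl unfolding finite_length_def by blast
  let ?c = "\<lambda>X A i. of_bool (isomorphic_modules \<Lambda> (factor_module M X A) (S i)) :: nat"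
  have nz: False if "A \<subset> {\<zero>\<^bsub>M\<^esub>}" "comp_factors \<Lambda> S M A u" for A u
    using submoduleD(2)[OF comp_factors_submodule[OF that(2)]] that(1) by auto
  show ?thesis
    using assms(2-)
  proof (induction "\<phi> X" arbitrary: X v w rule: less_induct)
    case less
    from less.prems(1) show ?case
    proof cases
      case v0: zero
      from less.prems(2) show ?thesis
        by cases (use v0 nz in auto)
    next
      case v: (step A v')
      from less.prems(2) show ?thesis
      proof cases
        case zero
        then show ?thesis using v nz by auto
      next
        case w: (step B w')
        note A = comp_factors_submodule[OF v(2)] and B = comp_factors_submodule[OF w(2)]
        note phiA = \<phi>[OF A v(3,4)] and phiB = \<phi>[OF B w(3,4)]
        show ?thesis
        proof (cases "A = B")
          case True
          then show ?thesis using less.hyps[OF phiA v(2)] v w by auto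
        next
          case False
          let ?C = "A \<inter> B"
          have maxA: "\<And>C. \<lbrakk>submodule C \<Lambda> M; A \<subseteq> C; C \<subseteq> X\<rbrakk> \<Longrightarrow> C = A \<or> C = X"
            using v(5) simple_factor_iff[OF A v(3)] v(4) by auto
          have maxB: "\<And>C. \<lbrakk>submodule C \<Lambda> M; B \<subseteq> C; C \<subseteq> X\<rbrakk> \<Longrightarrow> C = B \<or> C = X"
            using w(5) simple_factor_iff[OF B w(3)] w(4) by auto
          \<comment> \<open>If the sum were not \<open>X\<close>, maximality of \<open>A\<close> and
            of \<open>B\<close> would make it equal to both of them.\<close>
          have sumX: "D <+>\<^bsub>M\<^esub> E = X" if DE: "D = A \<and> E = B \<or> D = B \<and> E = A" for D E
          proof -
            have DE': "submodule D \<Lambda> M" "submodule E \<Lambda> M" using DE A B by auto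
            have "D <+>\<^bsub>M\<^esub> E \<subseteq> X"
              using DE v(4) w(4) submoduleD(3)[OF v(3)] by (auto simp: set_add_def')
            then show ?thesis
              using subset_sum[OF DE'] sum_submodule[OF DE'] maxA maxB DE False v(4) w(4) by blast
          qed
          obtain u where u: "comp_factors \<Lambda> S M ?C u"
            using comp_factors_extend[OF fl comp_factors.zero Int_submodule[OF A B]]
              submoduleD(2)[OF A] submoduleD(2)[OF B] by auto
          \<comment> \<open>Stated for a general pair because both orders of \<open>A\<close> and
            \<open>B\<close> occur: \<open>E\<close> gets a series through the intersection, and its
            top factor contributes the same multiplicities as \<open>X / D\<close>.\<close>
          have *: "comp_factors \<Lambda> S M E (\<lambda>i. u i + ?c E ?C i) \<and> ?c E ?C = ?c X D"
            if DE: "D = A \<and> E = B \<or> D = B \<and> E = A" for D E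
          proof -
            have DE': "submodule D \<Lambda> M" "submodule E \<Lambda> M" using DE A B by auto
            have C: "?C = D \<inter> E" using DE by auto
            have EX: "D \<subseteq> X" "E \<subseteq> X" using DE v(4) w(4) by auto
            have "\<not> E \<subseteq> D" using DE maxA maxB A B v(4) w(4) False by blast
            then have CE: "?C \<subset> E" using C by auto
            have iso: "isomorphic_modules \<Lambda> (factor_module M E ?C) (factor_module M X D)"
              using second_isomorphism[OF DE'] sumX[OF DE] C by simp
            have r: "right_module \<Lambda> (factor_module M E ?C)" "right_module \<Lambda> (factor_module M X D)"
              using factor_right_module[OF Int_submodule[OF A B] DE'(2)]
                factor_right_module[OF DE'(1) v(3) EX(1)] CE by auto
            have iso': "isomorphic_modules \<Lambda> (factor_module M X D) (factor_module M E ?C)"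
              by (rule right_module.isomorphic_sym[OF r iso])
            have "simple_module \<Lambda> (factor_module M X D)" using DE v w by auto
            then have "simple_module \<Lambda> (factor_module M E ?C)"
              by (rule right_module.isomorphic_simple[OF r(2,1) iso'])
            from comp_factors.step[OF u DE'(2) CE this] show ?thesis
              using isomorphic_modules_trans[OF iso] isomorphic_modules_trans[OF iso'] by fastforce
          qed
          \<comment> \<open>\<open>A\<close> and \<open>B\<close> have smaller rank than
            \<open>X\<close>, so the induction hypothesis identifies \<open>v'\<close> and
            \<open>w'\<close>. Both \<open>v\<close> and \<open>w\<close> are then \<open>u\<close>
            plus the same two contributions, in opposite order.\<close>
          have "v' = (\<lambda>i. u i + ?c A ?C i)" "?c A ?C = ?c X B"
            using *[of B A] less.hyps[OF phiA v(2)] by auto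
          moreover have "w' = (\<lambda>i. u i + ?c B ?C i)" "?c B ?C = ?c X A"
            using *[of A B] less.hyps[OF phiB w(2)] by auto
          ultimately show ?thesis unfolding v(1) w(1) by (simp add: fun_eq_iff)
        qed
      qed
    qed
  qed
qed

text \<open>The dimension vector of a submodule is defined through series of \<open>N\<close> as a
  module of its own. This moves such series into \<open>M\<close>, where uniqueness can compare them
  with others.\<close>

lemma comp_factors_restrict:
  assumes N: "submodule N \<Lambda> M" and "comp_factors \<Lambda> S (M\<lparr>carrier := N\<rparr>) X v"
  shows "comp_factors \<Lambda> S M X v"
  using assms(2)
proof induction
  case zero
  then show ?case using comp_factors.zero[of \<Lambda> S M] by simp
next
  case (step A v X)
  have "factor_module (M\<lparr>carrier := N\<rparr>) X A = factor_module M X A" by (simp add: factor_module_def)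
  then show ?case
    using comp_factors.step[OF step.IH, of X] step.hyps by (simp add: submodule_restrict_iff[OF N])
qed

text \<open>\<open>A\<close> is added to every term of the series of \<open>B\<close>. The series of
  \<open>A\<close> then continues up to \<open>A + B\<close>, and each new factor is isomorphic to
  the corresponding factor in \<open>B\<close> by the second isomorphism theorem.\<close>

lemma comp_factors_direct_sum:
  assumes "comp_factors \<Lambda> S M B w" "A \<inter> B = {\<zero>\<^bsub>M\<^esub>}" "comp_factors \<Lambda> S M A v"
  shows "comp_factors \<Lambda> S M (A <+>\<^bsub>M\<^esub> B) (\<lambda>i. v i + w i)"
  using assms
proof induction
  case zero
  have "A <+>\<^bsub>M\<^esub> {\<zero>\<^bsub>M\<^esub>} = A"
    using submoduleD(1)[OF comp_factors_submodule[OF zero(2)]] by (auto simp: set_add_def' subset_iff)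
  then show ?case using zero by simp
next
  case (step B w X)
  note A = comp_factors_submodule[OF step.prems(2)] and B = comp_factors_submodule[OF step.hyps(1)]
  note X = step.hyps(2)
  let ?AB = "A <+>\<^bsub>M\<^esub> B" and ?AX = "A <+>\<^bsub>M\<^esub> X"
  note AB = sum_submodule[OF A B] and AX = sum_submodule[OF A X]
  have carr: "\<And>x. x \<in> A \<or> x \<in> X \<Longrightarrow> x \<in> carrier M" using submoduleD(1)[OF A] submoduleD(1)[OF X] by auto
  \<comment> \<open>Modular law: for \<open>x = a + b\<close> in \<open>X\<close> the component
    \<open>a = x - b\<close> lies in both \<open>A\<close> and \<open>X\<close>, whose intersection
    is zero.\<close>
  have int: "?AB \<inter> X = B"
  proof
    show "B \<subseteq> ?AB \<inter> X" using subset_sum[OF A B] step.hyps(3) by auto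
    show "?AB \<inter> X \<subseteq> B"
    proof
      fix x assume "x \<in> ?AB \<inter> X"
      then obtain a b where ab: "a \<in> A" "b \<in> B" "x = a \<oplus>\<^bsub>M\<^esub> b" and x: "x \<in> X"
        by (auto simp: set_add_def')
      have c: "a \<in> carrier M" "b \<in> carrier M" using ab carr step.hyps(3) by auto
      have "x \<oplus>\<^bsub>M\<^esub> \<ominus>\<^bsub>M\<^esub> b \<in> X"
        using x ab step.hyps(3) submoduleD(3,5)[OF X] by auto
      moreover have "x \<oplus>\<^bsub>M\<^esub> \<ominus>\<^bsub>M\<^esub> b = a" using ab c by (simp add: M.a_assoc M.r_neg)
      ultimately have "a \<in> A \<inter> X" using ab by simp
      then have "a = \<zero>\<^bsub>M\<^esub>" using step.prems(1) by blast
      then show "x \<in> B" using ab c by simp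
    qed
  qed
  have sum: "?AB <+>\<^bsub>M\<^esub> X = ?AX"
  proof
    show "?AB <+>\<^bsub>M\<^esub> X \<subseteq> ?AX"
    proof
      fix y assume "y \<in> ?AB <+>\<^bsub>M\<^esub> X"
      then obtain a b x where abx: "a \<in> A" "b \<in> B" "x \<in> X" "y = (a \<oplus>\<^bsub>M\<^esub> b) \<oplus>\<^bsub>M\<^esub> x"
        by (auto simp: set_add_def')
      then have "y = a \<oplus>\<^bsub>M\<^esub> (b \<oplus>\<^bsub>M\<^esub> x)" "b \<oplus>\<^bsub>M\<^esub> x \<in> X"
        using carr step.hyps(3) submoduleD(3)[OF X] by (auto simp: M.a_assoc)
      then show "y \<in> ?AX" using abx by (auto simp: set_add_def')
    qed
    show "?AX \<subseteq> ?AB <+>\<^bsub>M\<^esub> X"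
      using subset_sum(1)[OF A B] unfolding set_add_defs by fast
  qed
  have sub: "?AB \<subseteq> ?AX" using subset_sum(1)[OF AB X] sum by simp
  have ne: "?AB \<noteq> ?AX" using int subset_sum(2)[OF A X] step.hyps(3) by auto
  have iso: "isomorphic_modules \<Lambda> (factor_module M X B) (factor_module M ?AX ?AB)"
    using second_isomorphism[OF AB X] int sum by simp
  have r: "right_module \<Lambda> (factor_module M X B)" "right_module \<Lambda> (factor_module M ?AX ?AB)"
    using factor_right_module[OF B X] factor_right_module[OF AB AX sub] step.hyps(3) by auto
  have simple: "simple_module \<Lambda> (factor_module M ?AX ?AB)"
    by (rule right_module.isomorphic_simple[OF r iso step.hyps(4)])
  have iso': "isomorphic_modules \<Lambda> (factor_module M ?AX ?AB) (factor_module M X B)"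
    by (rule right_module.isomorphic_sym[OF r iso])
  have "A \<inter> B = {\<zero>\<^bsub>M\<^esub>}"
    using step.prems(1) step.hyps(3) submoduleD(2)[OF A] submoduleD(2)[OF B] by blast
  note st = comp_factors.step[OF step.IH[OF this step.prems(2)] AX _ simple]
  have "isomorphic_modules \<Lambda> (factor_module M ?AX ?AB) (S i) \<longleftrightarrow>
      isomorphic_modules \<Lambda> (factor_module M X B) (S i)" for i
    using isomorphic_modules_trans[OF iso] isomorphic_modules_trans[OF iso'] by blast
  then show ?case using st sub ne by (simp add: psubset_eq add.assoc)
qed

text \<open>An isomorphism carries the series to its image. Composing \<open>f\<close> with the
  projection modulo the image of \<open>A\<close> gives an epimorphism on \<open>X\<close> with
  kernel \<open>A\<close>, so corresponding factors are isomorphic and are counted at the same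
  indices.\<close>

lemma comp_factors_isomorphic:
  assumes f: "module_epi \<Lambda> M T f" and k: "\<And>x. x \<in> carrier M \<Longrightarrow> f x = \<zero>\<^bsub>T\<^esub> \<longleftrightarrow> x = \<zero>\<^bsub>M\<^esub>"
    and "comp_factors \<Lambda> S M X v"
  shows "comp_factors \<Lambda> S T (f ` X) v"
  using assms(3)
proof induction
  case zero
  then show ?case using comp_factors.zero[of \<Lambda> S T] f by (simp add: module_epi_def)
next
  case (step A v X)
  interpret T: right_module \<Lambda> T by (rule epi_right_module[OF f])
  note X = step.hyps(2) and A = comp_factors_submodule[OF step.hyps(1)]
  note fX = epi_image_submodule[OF f X] and fA = epi_image_submodule[OF f A]
  have AX: "A \<subseteq> X" using step.hyps by auto
  have inj: "f x = f y \<longleftrightarrow> x = y" if "x \<in> carrier M" "y \<in> carrier M" for x y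
    using epi_eq_iff[OF f that] epi_eq_iff[OF epi_id that] k[of "x \<ominus>\<^bsub>M\<^esub> y"] that by simp
  have mem: "f x \<in> f ` C \<longleftrightarrow> x \<in> C" if "x \<in> carrier M" "C \<subseteq> carrier M" for x C
    using inj that by (metis image_iff subsetD)
  have sub: "f ` A \<subset> f ` X"
    using step.hyps(3) mem submoduleD(1)[OF X] submoduleD(1)[OF A] by blast
  then have sub': "f ` A \<subseteq> f ` X" by blast
  obtain p where p: "module_epi \<Lambda> (T\<lparr>carrier := f ` X\<rparr>) (factor_module T (f ` X) (f ` A)) p"
    "\<And>x. x \<in> f ` X \<Longrightarrow> p x = \<zero>\<^bsub>factor_module T (f ` X) (f ` A)\<^esub> \<longleftrightarrow> x \<in> f ` A"
    by (rule T.factor_epi[OF fA fX sub']) (rule that)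
  have "module_epi \<Lambda> (M\<lparr>carrier := X\<rparr>) (T\<lparr>carrier := f ` X\<rparr>) f"
    using f submoduleD(1)[OF X] by (auto simp: module_epi_def subset_iff)
  note q = module_epi_comp[OF this p(1)]
  have iso: "isomorphic_modules \<Lambda> (factor_module M X A) (factor_module T (f ` X) (f ` A))"
  proof (rule isomorphic_factor[OF A X AX q])
    show "(p \<circ> f) x = \<zero>\<^bsub>factor_module T (f ` X) (f ` A)\<^esub> \<longleftrightarrow> x \<in> A" if "x \<in> X" for x
      using p(2)[of "f x"] mem[of x A] submoduleD(1)[OF X] submoduleD(1)[OF A] that by auto
  qed
  have r: "right_module \<Lambda> (factor_module M X A)" "right_module \<Lambda> (factor_module T (f ` X) (f ` A))"
    using factor_right_module[OF A X AX] T.factor_right_module[OF fA fX sub'] by auto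
  have iso': "isomorphic_modules \<Lambda> (factor_module T (f ` X) (f ` A)) (factor_module M X A)"
    by (rule right_module.isomorphic_sym[OF r iso])
  have "simple_module \<Lambda> (factor_module T (f ` X) (f ` A))"
    by (rule right_module.isomorphic_simple[OF r iso step.hyps(4)])
  note st = comp_factors.step[OF step.IH fX sub this]
  have "isomorphic_modules \<Lambda> (factor_module T (f ` X) (f ` A)) (S i) \<longleftrightarrow>
      isomorphic_modules \<Lambda> (factor_module M X A) (S i)" for i
    using isomorphic_modules_trans[OF iso] isomorphic_modules_trans[OF iso'] by blast
  then show ?case using st by simp
qed

section \<open>Series as lists of submodules\<close>

lemma composition_series_comp_factors:
  assumes "composition_series \<Lambda> M Ns"
  shows "comp_factors \<Lambda> S M (carrier M)
    (\<lambda>i. card {k. Suc k < length Ns \<and> isomorphic_modules \<Lambda> (factor_module M (Ns ! Suc k) (Ns ! k)) (S i)})"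
proof -
  let ?iso = "\<lambda>i k. isomorphic_modules \<Lambda> (factor_module M (Ns ! Suc k) (Ns ! k)) (S i)"
  have ne: "Ns \<noteq> []" and hd: "hd Ns = {\<zero>\<^bsub>M\<^esub>}" and last: "last Ns = carrier M"
    and sub: "\<And>N. N \<in> set Ns \<Longrightarrow> submodule N \<Lambda> M"
    and st: "\<And>k. Suc k < length Ns \<Longrightarrow> Ns ! k \<subset> Ns ! Suc k \<and> simple_module \<Lambda> (factor_module M (Ns ! Suc k) (Ns ! k))"
    using assms by (auto simp: composition_series_def)
  \<comment> \<open>The first \<open>m\<close> steps end at \<open>Ns ! m\<close>. For
    \<open>m = length Ns - 1\<close> the bound \<open>k < m\<close> turns into
    \<open>Suc k < length Ns\<close>, and the end is the whole module.\<close>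
  have "comp_factors \<Lambda> S M (Ns ! m) (\<lambda>i. card {k. k < m \<and> ?iso i k})" if "m < length Ns" for m
    using that
  proof (induction m)
    case 0
    then show ?case using hd ne comp_factors.zero[of \<Lambda> S M] by (simp add: hd_conv_nth)
  next
    case (Suc m)
    have "{k. k < Suc m \<and> ?iso i k} = {k. k < m \<and> ?iso i k} \<union> (if ?iso i m then {m} else {})" for i
      by (auto simp: less_Suc_eq)
    then have "card {k. k < Suc m \<and> ?iso i k} = card {k. k < m \<and> ?iso i k} + of_bool (?iso i m)" for i
      by simp
    then show ?case
      using comp_factors.step[OF Suc.IH sub[OF nth_mem[OF Suc.prems]]] st[OF Suc.prems] Suc.prems by simp
  qed
  from this[of "length Ns - 1"] show ?thesis
    using ne last by (simp add: last_conv_nth less_diff_conv)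
qed

text \<open>Together with the existence of \<open>comp_factors\<close> this guarantees that the
  \<open>SOME\<close> in \<open>dimension_vector\<close> selects an actual series. The end
  \<open>X\<close> is left general for the induction.\<close>

lemma comp_factors_composition_series:
  assumes "comp_factors \<Lambda> S M X v"
  shows "\<exists>Ns. Ns \<noteq> [] \<and> hd Ns = {\<zero>\<^bsub>M\<^esub>} \<and> last Ns = X \<and> (\<forall>N\<in>set Ns. submodule N \<Lambda> M) \<and>
    (\<forall>k. Suc k < length Ns \<longrightarrow>
        Ns ! k \<subset> Ns ! Suc k \<and> simple_module \<Lambda> (factor_module M (Ns ! Suc k) (Ns ! k)))"
  using assms
proof induction
  case zero
  then show ?case by (intro exI[of _ "[{\<zero>\<^bsub>M\<^esub>}]"]) (simp add: zero_submodule)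
next
  case (step A v X)
  then obtain Ns where Ns: "Ns \<noteq> []" "hd Ns = {\<zero>\<^bsub>M\<^esub>}" "last Ns = A" "\<forall>N\<in>set Ns. submodule N \<Lambda> M"
    "\<And>k. Suc k < length Ns \<Longrightarrow>
        Ns ! k \<subset> Ns ! Suc k \<and> simple_module \<Lambda> (factor_module M (Ns ! Suc k) (Ns ! k))"
    by auto
  have "(Ns @ [X]) ! k \<subset> (Ns @ [X]) ! Suc k \<and>
      simple_module \<Lambda> (factor_module M ((Ns @ [X]) ! Suc k) ((Ns @ [X]) ! k))"
    if "Suc k < length (Ns @ [X])" for k
  proof (cases "Suc k < length Ns")
    case True
    then show ?thesis using Ns(5)[OF True] by (simp add: nth_append)
  next
    case False
    then have "k = length Ns - 1" "Suc k = length Ns" using that by auto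
    then show ?thesis using step.hyps Ns(1,3) by (simp add: nth_append last_conv_nth)
  qed
  then show ?case using Ns step.hyps by (intro exI[of _ "Ns @ [X]"]) auto
qed

end

section \<open>Finite dimensional modules\<close>

text \<open>A span built one vector at a time, \<open>W\<close> growing to \<open>W + R b\<close>;
  \<open>b\<close> may already lie in \<open>W\<close>. Such a flag takes the place of a basis in
  inductions on dimension, with \<open>K\<close> as the ring of scalars.\<close>

inductive finitely_spanned :: "('a, 'r) ring_scheme \<Rightarrow> ('a, 'm) module \<Rightarrow> 'm set \<Rightarrow> bool" for R V where
  zero: "finitely_spanned R V {\<zero>\<^bsub>V\<^esub>}"
| step: "\<lbrakk>finitely_spanned R V W; b \<in> carrier V\<rbrakk> \<Longrightarrow>
    finitely_spanned R V {w \<oplus>\<^bsub>V\<^esub> c \<odot>\<^bsub>V\<^esub> b | w c. w \<in> W \<and> c \<in> carrier R}"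

context right_module
begin

lemma finitely_spanned_submodule: "finitely_spanned \<Lambda> M W \<Longrightarrow> submodule W \<Lambda> M"
proof (induction rule: finitely_spanned.induct)
  case (step W b)
  have carr: "\<And>w. w \<in> W \<Longrightarrow> w \<in> carrier M" using submoduleD(1)[OF step.IH] by auto
  show ?case unfolding submodule_iff
  proof (intro conjI ballI)
    show "\<zero>\<^bsub>M\<^esub> \<in> {w \<oplus>\<^bsub>M\<^esub> c \<odot>\<^bsub>M\<^esub> b |w c. w \<in> W \<and> c \<in> carrier \<Lambda>}"
      using submoduleD(2)[OF step.IH] step.hyps(2) zero_act[of b]
      by (intro CollectI exI[of _ "\<zero>\<^bsub>M\<^esub>"] exI[of _ "\<zero>\<^bsub>\<Lambda>\<^esub>"]) auto
  next
    fix x y assume "x \<in> {w \<oplus>\<^bsub>M\<^esub> c \<odot>\<^bsub>M\<^esub> b |w c. w \<in> W \<and> c \<in> carrier \<Lambda>}"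
      "y \<in> {w \<oplus>\<^bsub>M\<^esub> c \<odot>\<^bsub>M\<^esub> b |w c. w \<in> W \<and> c \<in> carrier \<Lambda>}"
    then obtain w c v d where *: "w \<in> W" "c \<in> carrier \<Lambda>" "x = w \<oplus>\<^bsub>M\<^esub> c \<odot>\<^bsub>M\<^esub> b"
      "v \<in> W" "d \<in> carrier \<Lambda>" "y = v \<oplus>\<^bsub>M\<^esub> d \<odot>\<^bsub>M\<^esub> b" by auto
    then have "x \<oplus>\<^bsub>M\<^esub> y = (w \<oplus>\<^bsub>M\<^esub> v) \<oplus>\<^bsub>M\<^esub> (c \<oplus>\<^bsub>\<Lambda>\<^esub> d) \<odot>\<^bsub>M\<^esub> b"
      using carr step.hyps(2) by (simp add: act_add_scalar act_closed M.a_ac)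
    then show "x \<oplus>\<^bsub>M\<^esub> y \<in> {w \<oplus>\<^bsub>M\<^esub> c \<odot>\<^bsub>M\<^esub> b |w c. w \<in> W \<and> c \<in> carrier \<Lambda>}"
      using * submoduleD(3)[OF step.IH] by blast
  next
    fix a x assume a: "a \<in> carrier \<Lambda>" and "x \<in> {w \<oplus>\<^bsub>M\<^esub> c \<odot>\<^bsub>M\<^esub> b |w c. w \<in> W \<and> c \<in> carrier \<Lambda>}"
    then obtain w c where *: "w \<in> W" "c \<in> carrier \<Lambda>" "x = w \<oplus>\<^bsub>M\<^esub> c \<odot>\<^bsub>M\<^esub> b" by auto
    then have "a \<odot>\<^bsub>M\<^esub> x = a \<odot>\<^bsub>M\<^esub> w \<oplus>\<^bsub>M\<^esub> (c \<otimes>\<^bsub>\<Lambda>\<^esub> a) \<odot>\<^bsub>M\<^esub> b"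
      using carr step.hyps(2) a by (simp add: act_add act_mult act_closed)
    then show "a \<odot>\<^bsub>M\<^esub> x \<in> {w \<oplus>\<^bsub>M\<^esub> c \<odot>\<^bsub>M\<^esub> b |w c. w \<in> W \<and> c \<in> carrier \<Lambda>}"
      using * a submoduleD(4)[OF step.IH] by blast
  qed (use carr step.hyps(2) in \<open>auto intro!: act_closed\<close>)
qed (rule zero_submodule)

lemma finitely_spanned_combinations:
  assumes "finite B" "B \<subseteq> carrier M"
  shows "finitely_spanned \<Lambda> M {v. \<exists>c \<in> B \<rightarrow> carrier \<Lambda>. v = (\<Oplus>\<^bsub>M\<^esub>b\<in>B. c b \<odot>\<^bsub>M\<^esub> b)}"
  using assms
proof (induction B rule: finite_induct)
  case empty
  then show ?case using finitely_spanned.zero[of \<Lambda> M] by simp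
next
  case (insert x F)
  let ?W = "{v. \<exists>c \<in> F \<rightarrow> carrier \<Lambda>. v = (\<Oplus>\<^bsub>M\<^esub>b\<in>F. c b \<odot>\<^bsub>M\<^esub> b)}"
  have sum: "(\<Oplus>\<^bsub>M\<^esub>b\<in>insert x F. c b \<odot>\<^bsub>M\<^esub> b) = (\<Oplus>\<^bsub>M\<^esub>b\<in>F. c b \<odot>\<^bsub>M\<^esub> b) \<oplus>\<^bsub>M\<^esub> c x \<odot>\<^bsub>M\<^esub> x"
    and closed: "(\<Oplus>\<^bsub>M\<^esub>b\<in>F. c b \<odot>\<^bsub>M\<^esub> b) \<in> carrier M"
    if "c \<in> insert x F \<rightarrow> carrier \<Lambda>" for c
  proof -
    have c: "(\<lambda>b. c b \<odot>\<^bsub>M\<^esub> b) \<in> F \<rightarrow> carrier M" "c x \<odot>\<^bsub>M\<^esub> x \<in> carrier M"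
      using that insert.prems by (auto simp: Pi_iff intro!: act_closed)
    show "(\<Oplus>\<^bsub>M\<^esub>b\<in>F. c b \<odot>\<^bsub>M\<^esub> b) \<in> carrier M" using c by (rule_tac M.finsum_closed)
    then show "(\<Oplus>\<^bsub>M\<^esub>b\<in>insert x F. c b \<odot>\<^bsub>M\<^esub> b) = (\<Oplus>\<^bsub>M\<^esub>b\<in>F. c b \<odot>\<^bsub>M\<^esub> b) \<oplus>\<^bsub>M\<^esub> c x \<odot>\<^bsub>M\<^esub> x"
      using M.finsum_insert[OF insert.hyps c] c by (simp add: M.a_comm)
  qed
  have "{v. \<exists>c \<in> insert x F \<rightarrow> carrier \<Lambda>. v = (\<Oplus>\<^bsub>M\<^esub>b\<in>insert x F. c b \<odot>\<^bsub>M\<^esub> b)} =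
      {w \<oplus>\<^bsub>M\<^esub> a \<odot>\<^bsub>M\<^esub> x | w a. w \<in> ?W \<and> a \<in> carrier \<Lambda>}" (is "?L = ?R")
  proof
    show "?L \<subseteq> ?R"
    proof
      fix v assume "v \<in> ?L"
      then obtain c where c: "c \<in> insert x F \<rightarrow> carrier \<Lambda>" "v = (\<Oplus>\<^bsub>M\<^esub>b\<in>insert x F. c b \<odot>\<^bsub>M\<^esub> b)" by auto
      then have "c \<in> F \<rightarrow> carrier \<Lambda>" "c x \<in> carrier \<Lambda>" by auto
      then show "v \<in> ?R" using sum[OF c(1)] c(2) by blast
    qed
    show "?R \<subseteq> ?L"
    proof
      fix v assume "v \<in> ?R"
      then obtain c a where c: "c \<in> F \<rightarrow> carrier \<Lambda>" "a \<in> carrier \<Lambda>"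
        "v = (\<Oplus>\<^bsub>M\<^esub>b\<in>F. c b \<odot>\<^bsub>M\<^esub> b) \<oplus>\<^bsub>M\<^esub> a \<odot>\<^bsub>M\<^esub> x" by auto
      let ?c = "c(x := a)"
      have c': "?c \<in> insert x F \<rightarrow> carrier \<Lambda>" using c by auto
      have "(\<Oplus>\<^bsub>M\<^esub>b\<in>F. ?c b \<odot>\<^bsub>M\<^esub> b) = (\<Oplus>\<^bsub>M\<^esub>b\<in>F. c b \<odot>\<^bsub>M\<^esub> b)"
        using c insert.hyps insert.prems by (intro M.finsum_cong') (auto intro!: act_closed)
      then have "v = (\<Oplus>\<^bsub>M\<^esub>b\<in>insert x F. ?c b \<odot>\<^bsub>M\<^esub> b)" using sum[OF c'] c(3) by simp
      then show "v \<in> ?L" using c' by blast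
    qed
  qed
  then show ?case using finitely_spanned.step[OF insert.IH, of x] insert.prems by simp
qed

text \<open>The clause \<open>B \<subseteq> W\<close> strengthens the induction: a new vector
  \<open>b\<close> outside \<open>W\<close> is then not in \<open>B\<close>, so giving it a
  coefficient does not disturb the combination over \<open>B\<close>. If \<open>b\<close> already
  lies in \<open>W\<close>, the set \<open>B\<close> is kept.\<close>

lemma finitely_spanned_imp_combinations:
  assumes "finitely_spanned \<Lambda> M W"
  shows "\<exists>B. finite B \<and> B \<subseteq> W \<and> (\<forall>v\<in>W. \<exists>c \<in> B \<rightarrow> carrier \<Lambda>. v = (\<Oplus>\<^bsub>M\<^esub>b\<in>B. c b \<odot>\<^bsub>M\<^esub> b))"
  using assms
proof induction
  case zero
  show ?case by (intro exI[of _ "{}"]) simp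
next
  case (step W b)
  note W = finitely_spanned_submodule[OF step.hyps(1)]
  let ?W = "{w \<oplus>\<^bsub>M\<^esub> c \<odot>\<^bsub>M\<^esub> b |w c. w \<in> W \<and> c \<in> carrier \<Lambda>}"
  from step.IH obtain B where B: "finite B" "B \<subseteq> W"
    "\<And>v. v \<in> W \<Longrightarrow> \<exists>c \<in> B \<rightarrow> carrier \<Lambda>. v = (\<Oplus>\<^bsub>M\<^esub>b\<in>B. c b \<odot>\<^bsub>M\<^esub> b)" by blast
  have sub: "W \<subseteq> ?W"
  proof
    fix w assume w: "w \<in> W"
    then have "w = w \<oplus>\<^bsub>M\<^esub> \<zero>\<^bsub>\<Lambda>\<^esub> \<odot>\<^bsub>M\<^esub> b"
      using step.hyps(2) submoduleD(1)[OF W] by (simp add: zero_act subset_iff)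
    then show "w \<in> ?W" using w by blast
  qed
  have b: "b \<in> ?W"
    using step.hyps(2) submoduleD(2)[OF W] act_one[of b]
    by (intro CollectI exI[of _ "\<zero>\<^bsub>M\<^esub>"] exI[of _ "\<one>\<^bsub>\<Lambda>\<^esub>"]) simp
  show ?case
  proof (cases "b \<in> W")
    case True
    then have "?W \<subseteq> W" using submoduleD(3,4)[OF W] by auto
    then show ?thesis using B sub by (intro exI[of _ B]) blast
  next
    case False
    have "\<exists>c \<in> insert b B \<rightarrow> carrier \<Lambda>. v = (\<Oplus>\<^bsub>M\<^esub>b\<in>insert b B. c b \<odot>\<^bsub>M\<^esub> b)" if v: "v \<in> ?W" for v
    proof -
      obtain w a where w: "w \<in> W" "a \<in> carrier \<Lambda>" "v = w \<oplus>\<^bsub>M\<^esub> a \<odot>\<^bsub>M\<^esub> b" using v by auto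
      obtain c where c: "c \<in> B \<rightarrow> carrier \<Lambda>" "w = (\<Oplus>\<^bsub>M\<^esub>b\<in>B. c b \<odot>\<^bsub>M\<^esub> b)" using B(3)[OF w(1)] by blast
      let ?c = "c(b := a)"
      have bB: "b \<notin> B" using False B by auto
      have BM: "B \<subseteq> carrier M" using B submoduleD(1)[OF W] by auto
      have cl: "(\<lambda>x. ?c x \<odot>\<^bsub>M\<^esub> x) \<in> B \<rightarrow> carrier M" "?c b \<odot>\<^bsub>M\<^esub> b \<in> carrier M"
        using c w BM step.hyps(2) by (auto simp: Pi_iff intro!: act_closed)
      have "(\<Oplus>\<^bsub>M\<^esub>x\<in>insert b B. ?c x \<odot>\<^bsub>M\<^esub> x) = a \<odot>\<^bsub>M\<^esub> b \<oplus>\<^bsub>M\<^esub> (\<Oplus>\<^bsub>M\<^esub>x\<in>B. ?c x \<odot>\<^bsub>M\<^esub> x)"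
        using M.finsum_insert[OF B(1) bB cl] by simp
      also have "(\<Oplus>\<^bsub>M\<^esub>x\<in>B. ?c x \<odot>\<^bsub>M\<^esub> x) = w"
        unfolding c(2) using bB c(1) BM by (intro M.finsum_cong') (auto intro!: act_closed)
      also have "a \<odot>\<^bsub>M\<^esub> b \<oplus>\<^bsub>M\<^esub> w = v"
        using w cl submoduleD(1)[OF W] by (simp add: M.a_comm subset_iff)
      finally show ?thesis using c(1) w(2) by (intro bexI[of _ ?c]) auto
    qed
    then show ?thesis using B b sub by (intro exI[of _ "insert b B"]) auto
  qed
qed

lemma finite_dimensional_iff: "finite_dimensional \<Lambda> M \<longleftrightarrow> finitely_spanned \<Lambda> M (carrier M)"
proof
  assume "finite_dimensional \<Lambda> M"
  then obtain B where B: "finite B" "B \<subseteq> carrier M"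
    "\<And>v. v \<in> carrier M \<Longrightarrow> \<exists>c \<in> B \<rightarrow> carrier \<Lambda>. v = (\<Oplus>\<^bsub>M\<^esub>b\<in>B. c b \<odot>\<^bsub>M\<^esub> b)"
    unfolding finite_dimensional_def by blast
  note fs = finitely_spanned_combinations[OF B(1,2)]
  have "{v. \<exists>c \<in> B \<rightarrow> carrier \<Lambda>. v = (\<Oplus>\<^bsub>M\<^esub>b\<in>B. c b \<odot>\<^bsub>M\<^esub> b)} = carrier M"
    using B(3) submoduleD(1)[OF finitely_spanned_submodule[OF fs]] by blast
  then show "finitely_spanned \<Lambda> M (carrier M)" using fs by simp
next
  assume "finitely_spanned \<Lambda> M (carrier M)"
  then show "finite_dimensional \<Lambda> M"
    unfolding finite_dimensional_def by (rule finitely_spanned_imp_combinations)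
qed

lemma finitely_spanned_restrict:
  assumes N: "submodule N \<Lambda> M" and "finitely_spanned \<Lambda> M W" "W \<subseteq> N"
  shows "finitely_spanned \<Lambda> (M\<lparr>carrier := N\<rparr>) W"
  using assms(2,3)
proof induction
  case zero
  then show ?case using finitely_spanned.zero[of \<Lambda> "M\<lparr>carrier := N\<rparr>"] by simp
next
  case (step W b)
  note W = submoduleD(1,2)[OF finitely_spanned_submodule[OF step.hyps(1)]]
  have "b = \<zero>\<^bsub>M\<^esub> \<oplus>\<^bsub>M\<^esub> \<one>\<^bsub>\<Lambda>\<^esub> \<odot>\<^bsub>M\<^esub> b" using step.hyps(2) act_one[of b] by simp
  then have b: "b \<in> N" using W step.prems by blast
  have "W \<subseteq> N"
  proof
    fix w assume w: "w \<in> W"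
    then have "w = w \<oplus>\<^bsub>M\<^esub> \<zero>\<^bsub>\<Lambda>\<^esub> \<odot>\<^bsub>M\<^esub> b"
      using step.hyps(2) W by (simp add: zero_act subset_iff)
    then show "w \<in> N" using w step.prems by blast
  qed
  from finitely_spanned.step[OF step.IH[OF this], of b] b show ?case by simp
qed

lemma finitely_spanned_epi:
  assumes f: "module_epi \<Lambda> M T f" and "finitely_spanned \<Lambda> M W"
  shows "finitely_spanned \<Lambda> T (f ` W)"
  using assms(2)
proof induction
  case zero
  then show ?case using finitely_spanned.zero[of \<Lambda> T] f by (simp add: module_epi_def)
next
  case (step W b)
  have carr: "\<And>w. w \<in> W \<Longrightarrow> w \<in> carrier M"
    using submoduleD(1)[OF finitely_spanned_submodule[OF step.hyps(1)]] by auto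
  have fc: "f (w \<oplus>\<^bsub>M\<^esub> c \<odot>\<^bsub>M\<^esub> b) = f w \<oplus>\<^bsub>T\<^esub> c \<odot>\<^bsub>T\<^esub> f b" if "w \<in> W" "c \<in> carrier \<Lambda>" for w c
    using f that carr step.hyps(2) by (simp add: module_epi_def act_closed)
  have "f ` {w \<oplus>\<^bsub>M\<^esub> c \<odot>\<^bsub>M\<^esub> b |w c. w \<in> W \<and> c \<in> carrier \<Lambda>} =
      {w \<oplus>\<^bsub>T\<^esub> c \<odot>\<^bsub>T\<^esub> f b |w c. w \<in> f ` W \<and> c \<in> carrier \<Lambda>}" (is "f ` ?L = ?R")
  proof
    show "f ` ?L \<subseteq> ?R" using fc by blast
    show "?R \<subseteq> f ` ?L"
    proof
      fix v assume "v \<in> ?R"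
      then obtain w c where "w \<in> W" "c \<in> carrier \<Lambda>" "v = f w \<oplus>\<^bsub>T\<^esub> c \<odot>\<^bsub>T\<^esub> f b" by auto
      then have "v = f (w \<oplus>\<^bsub>M\<^esub> c \<odot>\<^bsub>M\<^esub> b)" "w \<oplus>\<^bsub>M\<^esub> c \<odot>\<^bsub>M\<^esub> b \<in> ?L" using fc by auto
      then show "v \<in> f ` ?L" by blast
    qed
  qed
  moreover have "f b \<in> carrier T" using f step.hyps(2) by (auto simp: module_epi_def)
  ultimately show ?case using finitely_spanned.step[OF step.IH, of "f b"] by simp
qed

section \<open>Exchange, subspaces and chains over a field\<close>

lemma exchange:
  assumes "Ring.field \<Lambda>" and W: "submodule W \<Lambda> M" and b: "b \<in> carrier M"
    and y: "y \<in> {w \<oplus>\<^bsub>M\<^esub> c \<odot>\<^bsub>M\<^esub> b |w c. w \<in> W \<and> c \<in> carrier \<Lambda>}" "y \<notin> W"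
    and x: "x \<in> {w \<oplus>\<^bsub>M\<^esub> c \<odot>\<^bsub>M\<^esub> b |w c. w \<in> W \<and> c \<in> carrier \<Lambda>}"
  obtains u d where "u \<in> W" "d \<in> carrier \<Lambda>" "x = u \<oplus>\<^bsub>M\<^esub> d \<odot>\<^bsub>M\<^esub> y"
proof -
  interpret F: Ring.field \<Lambda> by (rule assms(1))
  have carr: "\<And>w. w \<in> W \<Longrightarrow> w \<in> carrier M" using submoduleD(1)[OF W] by auto
  obtain w c where w: "w \<in> W" "c \<in> carrier \<Lambda>" "y = w \<oplus>\<^bsub>M\<^esub> c \<odot>\<^bsub>M\<^esub> b" using y by auto
  obtain v e where v: "v \<in> W" "e \<in> carrier \<Lambda>" "x = v \<oplus>\<^bsub>M\<^esub> e \<odot>\<^bsub>M\<^esub> b" using x by auto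
  \<comment> \<open>\<open>y\<close> lies outside \<open>W\<close>, so its coefficient at
    \<open>b\<close> is nonzero and, over a field, a unit: \<open>b\<close> can be traded for
    \<open>y\<close>.\<close>
  have "c \<noteq> \<zero>\<^bsub>\<Lambda>\<^esub>"
  proof
    assume "c = \<zero>\<^bsub>\<Lambda>\<^esub>"
    then show False using w y(2) b carr by (simp add: zero_act)
  qed
  then have cU: "c \<in> Units \<Lambda>" using w F.field_Units by simp
  \<comment> \<open>Solves \<open>c d = e\<close> in this order, since acting by \<open>c\<close>
    and then by \<open>d\<close> is acting by the product \<open>c d\<close>. The vector
    \<open>d y\<close> then has the same \<open>b\<close>-part as \<open>x\<close>, and
    \<open>u\<close> corrects the part in \<open>W\<close>.\<close>
  define d where "d = inv\<^bsub>\<Lambda>\<^esub> c \<otimes>\<^bsub>\<Lambda>\<^esub> e"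
  have d: "d \<in> carrier \<Lambda>" and cd: "c \<otimes>\<^bsub>\<Lambda>\<^esub> d = e"
    using cU v w by (simp_all add: d_def flip: R.m_assoc)
  define u where "u = v \<oplus>\<^bsub>M\<^esub> \<ominus>\<^bsub>M\<^esub> (d \<odot>\<^bsub>M\<^esub> w)"
  have "u \<in> W" using submoduleD[OF W] d v w by (simp add: u_def)
  moreover have "d \<odot>\<^bsub>M\<^esub> y = d \<odot>\<^bsub>M\<^esub> w \<oplus>\<^bsub>M\<^esub> e \<odot>\<^bsub>M\<^esub> b"
    using w d carr b cd by (simp add: act_add act_closed flip: act_mult)
  then have "u \<oplus>\<^bsub>M\<^esub> d \<odot>\<^bsub>M\<^esub> y = v \<oplus>\<^bsub>M\<^esub> (\<ominus>\<^bsub>M\<^esub> (d \<odot>\<^bsub>M\<^esub> w) \<oplus>\<^bsub>M\<^esub> d \<odot>\<^bsub>M\<^esub> w) \<oplus>\<^bsub>M\<^esub> e \<odot>\<^bsub>M\<^esub> b"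
    using w v d carr b by (simp add: u_def act_closed M.a_assoc)
  then have "x = u \<oplus>\<^bsub>M\<^esub> d \<odot>\<^bsub>M\<^esub> y"
    using w v d carr b by (simp add: act_closed M.l_neg)
  ultimately show thesis using that d by blast
qed

text \<open>If \<open>N\<close> leaves \<open>W\<close> at some \<open>y\<close>, exchange shows
  that \<open>N\<close> is the sum of \<open>N \<inter> W\<close> and the line through
  \<open>y\<close>; the induction hypothesis covers \<open>N \<inter> W\<close>.\<close>

lemma finitely_spanned_subspace:
  assumes F: "Ring.field \<Lambda>" and "finitely_spanned \<Lambda> M W" "submodule N \<Lambda> M" "N \<subseteq> W"
  shows "finitely_spanned \<Lambda> M N"
  using assms(2-)
proof (induction arbitrary: N)
  case zero
  then have "N = {\<zero>\<^bsub>M\<^esub>}" using submoduleD(2)[OF zero(1)] by auto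
  then show ?case using finitely_spanned.zero[of \<Lambda> M] by simp
next
  case (step W b)
  note W = finitely_spanned_submodule[OF step.hyps(1)]
  show ?case
  proof (cases "N \<subseteq> W")
    case False
    then obtain y where y: "y \<in> N" "y \<notin> W" by auto
    note N = submoduleD[OF step.prems(1)]
    have fs: "finitely_spanned \<Lambda> M (N \<inter> W)" by (rule step.IH) (auto intro: Int_submodule W step.prems)
    have "N \<subseteq> {w \<oplus>\<^bsub>M\<^esub> c \<odot>\<^bsub>M\<^esub> y |w c. w \<in> N \<inter> W \<and> c \<in> carrier \<Lambda>}"
    proof
      fix x assume x: "x \<in> N"
      obtain u d where ud: "u \<in> W" "d \<in> carrier \<Lambda>" "x = u \<oplus>\<^bsub>M\<^esub> d \<odot>\<^bsub>M\<^esub> y"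
        by (rule exchange[OF F W step.hyps(2), of y x]) (use y x step.prems(2) in auto)
      have "x \<oplus>\<^bsub>M\<^esub> \<ominus>\<^bsub>M\<^esub> (d \<odot>\<^bsub>M\<^esub> y) \<in> N" using x y ud N by auto
      moreover have "u \<in> carrier M" "d \<odot>\<^bsub>M\<^esub> y \<in> carrier M"
        using ud submoduleD(1)[OF W] y N by (auto intro!: act_closed)
      then have "x \<oplus>\<^bsub>M\<^esub> \<ominus>\<^bsub>M\<^esub> (d \<odot>\<^bsub>M\<^esub> y) = u"
        unfolding ud(3) by (simp add: M.a_assoc M.r_neg)
      ultimately show "x \<in> {w \<oplus>\<^bsub>M\<^esub> c \<odot>\<^bsub>M\<^esub> y |w c. w \<in> N \<inter> W \<and> c \<in> carrier \<Lambda>}" using ud by auto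
    qed
    moreover have "{w \<oplus>\<^bsub>M\<^esub> c \<odot>\<^bsub>M\<^esub> y |w c. w \<in> N \<inter> W \<and> c \<in> carrier \<Lambda>} \<subseteq> N" using N y by auto
    ultimately have "N = {w \<oplus>\<^bsub>M\<^esub> c \<odot>\<^bsub>M\<^esub> y |w c. w \<in> N \<inter> W \<and> c \<in> carrier \<Lambda>}" by blast
    then show ?thesis using finitely_spanned.step[OF fs, of y] y N by auto
  qed (rule step.IH[OF step.prems(1)])
qed

text \<open>The chain bound counts the steps of a flag at which a subspace jumps.\<close>

lemma finitely_spanned_chain_bound:
  assumes F: "Ring.field \<Lambda>" and "finitely_spanned \<Lambda> M W"
  shows "\<exists>\<phi> :: 'm set \<Rightarrow> nat. \<forall>A B. submodule A \<Lambda> M \<longrightarrow> submodule B \<Lambda> M \<longrightarrow> B \<subseteq> W \<longrightarrow> A \<subset> B \<longrightarrow> \<phi> A < \<phi> B"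
  using assms(2)
proof induction
  case zero
  have False if "submodule A \<Lambda> M" "B \<subseteq> {\<zero>\<^bsub>M\<^esub>}" "A \<subset> B" for A B
    using that submoduleD(2)[OF that(1)] by auto
  then show ?case by blast
next
  case (step W b)
  note W = finitely_spanned_submodule[OF step.hyps(1)]
  obtain \<phi> :: "'m set \<Rightarrow> nat" where
    \<phi>: "\<And>A B. \<lbrakk>submodule A \<Lambda> M; submodule B \<Lambda> M; B \<subseteq> W; A \<subset> B\<rbrakk> \<Longrightarrow> \<phi> A < \<phi> B"
    using step.IH by blast
  \<comment> \<open>The second summand counts the last step of the flag, at which \<open>A\<close>
    jumps exactly when it is not contained in \<open>W\<close>.\<close>
  define \<psi> where "\<psi> A = \<phi> (A \<inter> W) + of_bool (\<not> A \<subseteq> W)" for A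
  have "\<psi> A < \<psi> B"
    if A: "submodule A \<Lambda> M" and B: "submodule B \<Lambda> M" and AB: "A \<subset> B"
      and BW: "B \<subseteq> {w \<oplus>\<^bsub>M\<^esub> c \<odot>\<^bsub>M\<^esub> b |w c. w \<in> W \<and> c \<in> carrier \<Lambda>}" for A B
  proof (cases "A \<inter> W = B \<inter> W")
    case False
    then have "A \<inter> W \<subset> B \<inter> W" using AB by blast
    then have "\<phi> (A \<inter> W) < \<phi> (B \<inter> W)" by (intro \<phi> Int_submodule A B W) auto
    then show ?thesis using AB by (auto simp: \<psi>_def)
  next
    case True
    \<comment> \<open>If \<open>A\<close> contained some \<open>y\<close> outside \<open>W\<close>,
      every \<open>x\<close> in \<open>B\<close> would be \<open>u + d y\<close> with
      \<open>u\<close> in \<open>B \<inter> W = A \<inter> W\<close>, so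
      \<open>B \<subseteq> A\<close>. Hence only \<open>B\<close> jumps at the last step.\<close>
    have "A \<subseteq> W"
    proof (rule ccontr)
      assume "\<not> A \<subseteq> W"
      then obtain y where y: "y \<in> A" "y \<notin> W" by auto
      have "x \<in> A" if x: "x \<in> B" for x
      proof -
        obtain u d where ud: "u \<in> W" "d \<in> carrier \<Lambda>" "x = u \<oplus>\<^bsub>M\<^esub> d \<odot>\<^bsub>M\<^esub> y"
          by (rule exchange[OF F W step.hyps(2), of y x]) (use y x BW AB in auto)
        have "d \<odot>\<^bsub>M\<^esub> y \<in> A" using submoduleD(4)[OF A] ud y by auto
        then have "x \<oplus>\<^bsub>M\<^esub> \<ominus>\<^bsub>M\<^esub> (d \<odot>\<^bsub>M\<^esub> y) \<in> B" using submoduleD(3,5)[OF B] x AB by auto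
        moreover have "u \<in> carrier M" "d \<odot>\<^bsub>M\<^esub> y \<in> carrier M"
          using ud submoduleD(1)[OF W] \<open>d \<odot>\<^bsub>M\<^esub> y \<in> A\<close> submoduleD(1)[OF A] by auto
        then have "x \<oplus>\<^bsub>M\<^esub> \<ominus>\<^bsub>M\<^esub> (d \<odot>\<^bsub>M\<^esub> y) = u"
          unfolding ud(3) by (simp add: M.a_assoc M.r_neg)
        ultimately have "u \<in> A" using True ud by auto
        then show ?thesis using submoduleD(3)[OF A] \<open>d \<odot>\<^bsub>M\<^esub> y \<in> A\<close> ud by auto
      qed
      then show False using AB by auto
    qed
    then have "\<not> B \<subseteq> W" using True AB by blast
    then show ?thesis using \<open>A \<subseteq> W\<close> True by (simp add: \<psi>_def)
  qed
  then show ?case by (intro exI[of _ \<psi>]) blast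
qed

end

text \<open>Any injection on the carrier turns its image into a module isomorphic to
  \<open>Q\<close>, with the operations computed through the inverse. This is what moves a module to
  another carrier type.\<close>

lemma transport_along_inj:
  assumes Q: "right_module \<Lambda> Q" and r: "inj_on r (carrier Q)"
  obtains T where "module_epi \<Lambda> Q T r" "\<And>x. x \<in> carrier Q \<Longrightarrow> r x = \<zero>\<^bsub>T\<^esub> \<longleftrightarrow> x = \<zero>\<^bsub>Q\<^esub>"
proof -
  interpret Q: right_module \<Lambda> Q by (rule Q)
  let ?i = "inv_into (carrier Q) r"
  let ?T = "\<lparr>carrier = r ` carrier Q, monoid.mult = undefined, monoid.one = undefined,
    ring.zero = r \<zero>\<^bsub>Q\<^esub>, ring.add = (\<lambda>x y. r (?i x \<oplus>\<^bsub>Q\<^esub> ?i y)), module.smult = (\<lambda>a x. r (a \<odot>\<^bsub>Q\<^esub> ?i x))\<rparr>"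
  show thesis
  proof (rule that[of ?T])
    show "module_epi \<Lambda> Q ?T r" using r by (simp add: module_epi_def)
    show "r x = \<zero>\<^bsub>?T\<^esub> \<longleftrightarrow> x = \<zero>\<^bsub>Q\<^esub>" if "x \<in> carrier Q" for x
      using r that by (simp add: inj_on_eq_iff)
  qed
qed

section \<open>Restriction of scalars to the field K\<close>

context fd_algebra
begin

lemma underlying_space_simps [simp]:
  "carrier (underlying_space M) = carrier M" "\<zero>\<^bsub>underlying_space M\<^esub> = \<zero>\<^bsub>M\<^esub>"
  "x \<oplus>\<^bsub>underlying_space M\<^esub> y = x \<oplus>\<^bsub>M\<^esub> y" "c \<odot>\<^bsub>underlying_space M\<^esub> x = (c \<odot>\<^bsub>\<Lambda>\<^esub> \<one>\<^bsub>\<Lambda>\<^esub>) \<odot>\<^bsub>M\<^esub> x"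
  "(underlying_space M)\<lparr>carrier := N\<rparr> = underlying_space (M\<lparr>carrier := N\<rparr>)"
  by (simp_all add: underlying_space_def)

lemma scalar_closed [simp]: "c \<in> carrier K \<Longrightarrow> c \<odot>\<^bsub>\<Lambda>\<^esub> \<one>\<^bsub>\<Lambda>\<^esub> \<in> carrier \<Lambda>"
  by simp

text \<open>Sending \<open>c\<close> to \<open>c 1\<close> is multiplicative:
  \<open>(c d) 1 = c (1 (d 1)) = (c 1) (d 1)\<close>. Restricting the action along this map gives a
  module over \<open>K\<close> in the sense of the same locale, so the results on right modules
  serve as linear algebra.\<close>

lemma underlying_space_right_module:
  assumes "right_module \<Lambda> M"
  shows "right_module K (underlying_space M)"
proof -
  interpret M: right_module \<Lambda> M by (rule assms)
  have "abelian_group (underlying_space M)"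
  proof (rule abelian_groupI)
    show "\<exists>y\<in>carrier (underlying_space M). y \<oplus>\<^bsub>underlying_space M\<^esub> x = \<zero>\<^bsub>underlying_space M\<^esub>"
      if "x \<in> carrier (underlying_space M)" for x
      using that by (intro bexI[of _ "\<ominus>\<^bsub>M\<^esub> x"]) (auto simp: M.M.l_neg)
  qed (auto simp: M.M.a_ac)
  moreover have "(c \<otimes>\<^bsub>K\<^esub> d) \<odot>\<^bsub>\<Lambda>\<^esub> \<one>\<^bsub>\<Lambda>\<^esub> = (c \<odot>\<^bsub>\<Lambda>\<^esub> \<one>\<^bsub>\<Lambda>\<^esub>) \<otimes>\<^bsub>\<Lambda>\<^esub> (d \<odot>\<^bsub>\<Lambda>\<^esub> \<one>\<^bsub>\<Lambda>\<^esub>)"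
    if "c \<in> carrier K" "d \<in> carrier K" for c d
    using that by (simp add: A.smult_assoc1 flip: smult_mult_left)
  ultimately show ?thesis
    by (intro right_module.intro right_module_axioms.intro K.ring_axioms)
      (auto simp: M.act_closed M.act_add M.act_add_scalar M.act_mult M.act_one A.smult_l_distr)
qed

lemma underlying_space_submodule:
  assumes M: "right_module \<Lambda> M" and N: "submodule N \<Lambda> M"
  shows "submodule N K (underlying_space M)"
  using right_module.submoduleD[OF M N]
  by (auto simp: right_module.submodule_iff[OF underlying_space_right_module[OF M]])

lemma underlying_space_epi: "module_epi \<Lambda> M T f \<Longrightarrow> module_epi K (underlying_space M) (underlying_space T) f"
  by (auto simp: module_epi_def)

lemma fd_module_iff:
  "fd_module M \<longleftrightarrow> right_module \<Lambda> M \<and> finitely_spanned K (underlying_space M) (carrier M)"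
  using right_module.finite_dimensional_iff[OF underlying_space_right_module, of M]
  by (auto simp: fd_module_def)

lemma fd_module_submodule:
  assumes M: "fd_module M" and N: "submodule N \<Lambda> M"
  shows "fd_module (M\<lparr>carrier := N\<rparr>)"
proof -
  have M': "right_module \<Lambda> M" "finitely_spanned K (underlying_space M) (carrier M)"
    using M by (auto simp: fd_module_iff)
  interpret U: right_module K "underlying_space M" by (rule underlying_space_right_module[OF M'(1)])
  note sN = underlying_space_submodule[OF M'(1) N]
  have "finitely_spanned K (underlying_space M) N"
    by (rule U.finitely_spanned_subspace[OF K.field_axioms M'(2) sN])
      (rule right_module.submoduleD(1)[OF M'(1) N])
  from U.finitely_spanned_restrict[OF sN this] show ?thesis
    using right_module.submodule_right_module[OF M'(1) N] by (simp add: fd_module_iff)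
qed

lemma fd_module_epi:
  assumes M: "fd_module M" and f: "module_epi \<Lambda> M T f"
  shows "fd_module T"
proof -
  have M': "right_module \<Lambda> M" "finitely_spanned K (underlying_space M) (carrier M)"
    using M by (auto simp: fd_module_iff)
  interpret U: right_module K "underlying_space M" by (rule underlying_space_right_module[OF M'(1)])
  have "f ` carrier M = carrier T" using f by (simp add: module_epi_def)
  then show ?thesis
    using U.finitely_spanned_epi[OF underlying_space_epi[OF f] M'(2)] right_module.epi_right_module[OF M'(1) f]
    by (simp add: fd_module_iff)
qed

text \<open>Every submodule over \<Lambda> is a subspace over \<open>K\<close>, so the rank on
  subspaces restricts to submodules.\<close>

lemma fd_module_finite_length:
  assumes M: "fd_module M"
  shows "finite_length \<Lambda> M"
proof -
  have M': "right_module \<Lambda> M" "finitely_spanned K (underlying_space M) (carrier M)"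
    using M by (auto simp: fd_module_iff)
  interpret U: right_module K "underlying_space M" by (rule underlying_space_right_module[OF M'(1)])
  obtain \<phi> :: "'b set \<Rightarrow> nat" where \<phi>: "\<And>A B. \<lbrakk>submodule A K (underlying_space M);
      submodule B K (underlying_space M); B \<subseteq> carrier M; A \<subset> B\<rbrakk> \<Longrightarrow> \<phi> A < \<phi> B"
    using U.finitely_spanned_chain_bound[OF K.field_axioms M'(2)] by blast
  have "\<phi> A < \<phi> B" if "submodule A \<Lambda> M" "submodule B \<Lambda> M" "A \<subset> B" for A B
    using that by (intro \<phi> underlying_space_submodule[OF M'(1)] right_module.submoduleD(1)[OF M'(1)])
  then show ?thesis unfolding finite_length_def by blast
qed

text \<open>A factor of an object of \<open>mod_objects\<close> is copied back into the carrier type \<open>nat \<Rightarrow> 'k\<close> by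
  choosing a representative in each coset.\<close>

lemma factor_module_copy:
  assumes M: "M \<in> mod_objects" and A: "submodule A \<Lambda> M" and X: "submodule X \<Lambda> M" and AX: "A \<subseteq> X"
  obtains T where "T \<in> mod_objects" "isomorphic_modules \<Lambda> (factor_module M X A) T"
proof -
  have fd: "fd_module M" using M by (simp add: mod_objects_def)
  then interpret M: right_module \<Lambda> M by (simp add: fd_module_iff)
  let ?Q = "factor_module M X A"
  interpret X: right_module \<Lambda> "M\<lparr>carrier := X\<rparr>" by (rule M.submodule_right_module[OF X])
  have "subgroup A (add_monoid (M\<lparr>carrier := X\<rparr>))"
    using A X AX M.submodule_restrict_iff[OF X, of A] by (simp add: submodule_def)
  then interpret A: abelian_subgroup A "M\<lparr>carrier := X\<rparr>"
    by (intro abelian_subgroupI3 additive_subgroupI X.M.abelian_group_axioms)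
  have carr: "carrier ?Q = a_rcosets\<^bsub>M\<lparr>carrier := X\<rparr>\<^esub> A" by (simp add: factor_module_def quotient_module_def)
  define r where "r C = (SOME x. x \<in> C)" for C :: "(nat \<Rightarrow> 'k) set"
  have rC: "r C \<in> C" if "C \<in> carrier ?Q" for C
  proof -
    have "C \<noteq> {}" using that A.a_rcos_self unfolding carr A_RCOSETS_def' by blast
    then show ?thesis by (simp add: r_def some_in_eq)
  qed
  \<comment> \<open>Distinct cosets are disjoint, so a representative determines its coset.\<close>
  have "inj_on r (carrier ?Q)"
  proof (rule inj_onI)
    fix C D assume CD: "C \<in> carrier ?Q" "D \<in> carrier ?Q" "r C = r D"
    then have "C \<inter> D \<noteq> {}" using rC[of C] rC[of D] by auto
    then show "C = D" using A.a_rcos_disjoint CD by (auto simp: carr pairwise_def disjnt_def)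
  qed
  note Q = M.factor_right_module[OF A X AX]
  obtain T where T: "module_epi \<Lambda> ?Q T r" "\<And>x. x \<in> carrier ?Q \<Longrightarrow> r x = \<zero>\<^bsub>T\<^esub> \<longleftrightarrow> x = \<zero>\<^bsub>?Q\<^esub>"
    by (rule transport_along_inj[OF Q \<open>inj_on r (carrier ?Q)\<close>]) (rule that)
  obtain p where "module_epi \<Lambda> (M\<lparr>carrier := X\<rparr>) ?Q p"
    by (rule M.factor_epi[OF A X AX]) (rule that)
  then have "fd_module ?Q" by (rule fd_module_epi[OF fd_module_submodule[OF fd X]])
  then have "T \<in> mod_objects" using fd_module_epi[OF _ T(1)] by (simp add: mod_objects_def)
  moreover have "isomorphic_modules \<Lambda> ?Q T" by (rule right_module.epi_isomorphic(1)[OF Q T])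
  ultimately show thesis by (rule that)
qed

end

section \<open>Dimension vectors\<close>

context fd_algebra_simples
begin

lemma mod_objectsD:
  assumes "M \<in> mod_objects"
  shows "right_module \<Lambda> M" "fd_module M" "finite_length \<Lambda> M"
  using assms fd_module_finite_length[of M] by (auto simp: mod_objects_def fd_module_iff)

lemma mod_objects_submodule:
  "M \<in> mod_objects \<Longrightarrow> submodule N \<Lambda> M \<Longrightarrow> M\<lparr>carrier := N\<rparr> \<in> mod_objects"
  using fd_module_submodule[of M N] by (simp add: mod_objects_def)

lemma ex_comp_factors:
  assumes M: "M \<in> mod_objects" and N: "submodule N \<Lambda> M"
  obtains v where "comp_factors \<Lambda> S M N v"
proof -
  interpret M: right_module \<Lambda> M by (rule mod_objectsD(1)[OF M])
  show thesis
    using M.comp_factors_extend[OF mod_objectsD(3)[OF M] comp_factors.zero N] M.submoduleD(2)[OF N] that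
    by auto
qed

text \<open>The series selected by \<open>SOME\<close> exists and, read in \<open>M\<close>, has the
  same multiplicities as any other series of \<open>N\<close> by uniqueness. All later facts on
  dimension vectors derive from this equation.\<close>

lemma dimension_vector_eq:
  assumes M: "M \<in> mod_objects" and v: "comp_factors \<Lambda> S M N v"
  shows "dimension_vector (M\<lparr>carrier := N\<rparr>) $ i = v i"
proof -
  interpret M: right_module \<Lambda> M by (rule mod_objectsD(1)[OF M])
  have N: "submodule N \<Lambda> M" by (rule M.comp_factors_submodule[OF v])
  let ?N = "M\<lparr>carrier := N\<rparr>"
  have N': "?N \<in> mod_objects" by (rule mod_objects_submodule[OF M N])
  interpret N: right_module \<Lambda> ?N by (rule mod_objectsD(1)[OF N'])
  obtain u where "comp_factors \<Lambda> S ?N (carrier ?N) u"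
    using ex_comp_factors[OF N' N.carrier_submodule] .
  from N.comp_factors_composition_series[OF this]
  have "\<exists>Ns. composition_series \<Lambda> ?N Ns" unfolding composition_series_def by blast
  then have "composition_series \<Lambda> ?N (SOME Ns. composition_series \<Lambda> ?N Ns)" by (rule someI_ex)
  from N.composition_series_comp_factors[OF this]
  have "comp_factors \<Lambda> S ?N N (\<lambda>i. dimension_vector ?N $ i)"
    by (simp add: dimension_vector_def Let_def)
  from M.comp_factors_unique[OF mod_objectsD(3)[OF M] M.comp_factors_restrict[OF N this] v]
  show ?thesis by (simp add: fun_eq_iff)
qed

lemma dimension_vector_eq_carrier:
  assumes "M \<in> mod_objects" "comp_factors \<Lambda> S M (carrier M) v"
  shows "dimension_vector M $ i = v i"
  using dimension_vector_eq[OF assms] by simp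

lemma rdim_zero: "M \<in> mod_objects \<Longrightarrow> rdim (M\<lparr>carrier := {\<zero>\<^bsub>M\<^esub>}\<rparr>) = 0"
  using dimension_vector_eq[OF _ comp_factors.zero] by (simp add: rdim_def vec_eq_iff)

lemma dimension_vector_mono:
  assumes M: "M \<in> mod_objects" and N: "submodule N \<Lambda> M"
  shows "dimension_vector (M\<lparr>carrier := N\<rparr>) $ i \<le> dimension_vector M $ i"
proof -
  interpret M: right_module \<Lambda> M by (rule mod_objectsD(1)[OF M])
  obtain v where v: "comp_factors \<Lambda> S M N v" using ex_comp_factors[OF M N] .
  obtain w where w: "comp_factors \<Lambda> S M (carrier M) w" "v \<le> w"
    using M.comp_factors_extend[OF mod_objectsD(3)[OF M] v M.carrier_submodule M.submoduleD(1)[OF N]] by auto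
  show ?thesis
    using dimension_vector_eq[OF M v] dimension_vector_eq_carrier[OF M w(1)] w(2) by (simp add: le_fun_def)
qed

text \<open>A series of a nonzero module has a last step, whose simple factor is isomorphic to some
  \<open>S i\<close> and is therefore counted.\<close>

lemma dimension_vector_pos:
  assumes M: "M \<in> mod_objects" and nz: "nonzero_module M"
  shows "\<exists>i. dimension_vector M $ i > 0"
proof -
  interpret M: right_module \<Lambda> M by (rule mod_objectsD(1)[OF M])
  obtain v where v: "comp_factors \<Lambda> S M (carrier M) v" using ex_comp_factors[OF M M.carrier_submodule] .
  from v show ?thesis
  proof cases
    case zero
    then show ?thesis using nz by (simp add: nonzero_module_def)
  next
    case (step A u)
    note A = M.comp_factors_submodule[OF step(2)]
    have sub: "A \<subseteq> carrier M" using step by auto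
    \<comment> \<open>\<open>S_complete\<close> covers members of \<open>mod_objects\<close>, while
      the factor module has cosets as elements; it is applied to a copy.\<close>
    obtain T where T: "T \<in> mod_objects" and iso: "isomorphic_modules \<Lambda> (factor_module M (carrier M) A) T"
      using factor_module_copy[OF M A step(3) sub] .
    have "simple_module \<Lambda> T"
      by (rule right_module.isomorphic_simple[OF M.factor_right_module[OF A step(3) sub]
            mod_objectsD(1)[OF T] iso step(5)])
    then obtain i where "isomorphic_modules \<Lambda> T (S i)" using S_complete[OF T] by blast
    then have "isomorphic_modules \<Lambda> (factor_module M (carrier M) A) (S i)"
      by (rule isomorphic_modules_trans[OF iso])
    then have "v i > 0" unfolding step(1) by simp
    then show ?thesis using dimension_vector_eq_carrier[OF M v] by auto
  qed
qed

lemma rdim_direct_sum: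
  assumes M: "M \<in> mod_objects" and A: "submodule A \<Lambda> M" and B: "submodule B \<Lambda> M"
    and "A <+>\<^bsub>M\<^esub> B = carrier M" "A \<inter> B = {\<zero>\<^bsub>M\<^esub>}"
  shows "rdim M = rdim (M\<lparr>carrier := A\<rparr>) + rdim (M\<lparr>carrier := B\<rparr>)"
proof -
  interpret M: right_module \<Lambda> M by (rule mod_objectsD(1)[OF M])
  obtain v where v: "comp_factors \<Lambda> S M A v" using ex_comp_factors[OF M A] .
  obtain w where w: "comp_factors \<Lambda> S M B w" using ex_comp_factors[OF M B] .
  have "comp_factors \<Lambda> S M (carrier M) (\<lambda>i. v i + w i)"
    using M.comp_factors_direct_sum[OF w assms(5) v] assms(4) by simp
  from dimension_vector_eq_carrier[OF M this] dimension_vector_eq[OF M v] dimension_vector_eq[OF M w]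
  show ?thesis by (simp add: rdim_def vec_eq_iff)
qed

lemma rdim_isomorphic:
  assumes M: "M \<in> mod_objects" and T: "T \<in> mod_objects" and iso: "isomorphic_modules \<Lambda> M T"
  shows "rdim M = rdim T"
proof -
  interpret M: right_module \<Lambda> M by (rule mod_objectsD(1)[OF M])
  obtain f where f: "module_epi \<Lambda> M T f" "\<And>x. x \<in> carrier M \<Longrightarrow> f x = \<zero>\<^bsub>T\<^esub> \<longleftrightarrow> x = \<zero>\<^bsub>M\<^esub>"
    by (rule M.isomorphic_imp_epi[OF mod_objectsD(1)[OF T] iso]) (rule that)
  obtain v where v: "comp_factors \<Lambda> S M (carrier M) v" using ex_comp_factors[OF M M.carrier_submodule] .
  have "f ` carrier M = carrier T" using f(1) by (simp add: module_epi_def)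
  then have "comp_factors \<Lambda> S T (carrier T) v" using M.comp_factors_isomorphic[OF f v] by simp
  from dimension_vector_eq_carrier[OF T this] dimension_vector_eq_carrier[OF M v]
  show ?thesis by (simp add: rdim_def vec_eq_iff)
qed

end

section \<open>Semistable pairs and stability paths\<close>

lemma stability_path_inner:
  "stability_path Z t \<bullet> d = t * (imag_path Z t \<bullet> d) - real_path Z t \<bullet> d"
  by (simp add: stability_path_def inner_diff_left)

lemma stability_path_has_vector_derivative:
  assumes "(real_path Z has_vector_derivative a') (at t)" "(imag_path Z has_vector_derivative b') (at t)"
  shows "(stability_path Z has_vector_derivative t *\<^sub>R b' + imag_path Z t - a') (at t)"
proof -
  have "((\<lambda>s. s *\<^sub>R imag_path Z s - real_path Z s) has_vector_derivative t *\<^sub>R b' + 1 *\<^sub>R imag_path Z t - a') (at t)"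
    by (intro has_vector_derivative_diff has_vector_derivative_scaleR assms DERIV_ident)
  then show ?thesis by (simp add: stability_path_def[abs_def])
qed

lemma stability_path_C1:
  assumes "nonlinear_stability_function Z"
  shows "stability_path Z C1_differentiable_on UNIV"
  using assms unfolding stability_path_def[abs_def] nonlinear_stability_function_def by auto

text \<open>The derivative vanishes on two half-lines, which are convex; the constants at the two
  ends may differ.\<close>

lemma eventually_constant:
  fixes f :: "real \<Rightarrow> 'a::real_normed_vector"
  assumes "\<forall>\<^sub>F t in at_infinity. (f has_vector_derivative 0) (at t)"
  shows "\<exists>c. \<forall>\<^sub>F t in at_bot. f t = c" "\<exists>c. \<forall>\<^sub>F t in at_top. f t = c"
proof -
  obtain r where r: "\<And>t. r \<le> \<bar>t\<bar> \<Longrightarrow> (f has_vector_derivative 0) (at t)"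
    using assms by (auto simp: eventually_at_infinity)
  have d: "(f has_vector_derivative 0) (at t within A)" if "r \<le> \<bar>t\<bar>" for t A
    using r[OF that] by (rule has_vector_derivative_at_within)
  obtain c where "\<And>t. t \<in> {..-\<bar>r\<bar>} \<Longrightarrow> f t = c"
    by (rule has_vector_derivative_zero_constant[of "{..-\<bar>r\<bar>}" f]) (auto intro: d)
  then show "\<exists>c. \<forall>\<^sub>F t in at_bot. f t = c" by (auto simp: eventually_at_bot_linorder)
  obtain c where "\<And>t. t \<in> {\<bar>r\<bar>..} \<Longrightarrow> f t = c"
    by (rule has_vector_derivative_zero_constant[of "{\<bar>r\<bar>..}" f]) (auto intro: d)
  then show "\<exists>c. \<forall>\<^sub>F t in at_top. f t = c" by (auto simp: eventually_at_top_linorder)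
qed

text \<open>Near either end the coefficient vectors are constants \<open>u\<close> and
  \<open>v\<close> with \<open>v\<close> positive, so coordinate \<open>i\<close> of the path is
  \<open>t * v $ i - u $ i\<close>, which changes sign at \<open>u $ i / v $ i\<close>. The finitely
  many coordinates are then combined.\<close>

lemma stability_path_sign:
  fixes Z :: "real \<Rightarrow> int ^ 'n::finite \<Rightarrow> complex"
  assumes "nonlinear_stability_function Z"
  shows "\<forall>\<^sub>F t in at_bot. \<forall>i. stability_path Z t $ i < 0"
    and "\<forall>\<^sub>F t in at_top. \<forall>i. stability_path Z t $ i > 0"
proof -
  have pos: "\<And>t i. imag_path Z t $ i > 0"
    and a: "\<forall>\<^sub>F t in at_infinity. (real_path Z has_vector_derivative 0) (at t)"
    and b: "\<forall>\<^sub>F t in at_infinity. (imag_path Z has_vector_derivative 0) (at t)"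
    using assms by (auto simp: nonlinear_stability_function_def)
  show "\<forall>\<^sub>F t in at_bot. \<forall>i. stability_path Z t $ i < 0"
  proof (rule eventually_all_finite)
    fix i :: 'n
    obtain u v where u: "\<forall>\<^sub>F t in at_bot. real_path Z t = u" and v: "\<forall>\<^sub>F t in at_bot. imag_path Z t = v"
      using eventually_constant(1)[OF a] eventually_constant(1)[OF b] by blast
    have "\<forall>\<^sub>F t::real in at_bot. t < u $ i / v $ i" by (rule eventually_gt_at_bot)
    then show "\<forall>\<^sub>F t in at_bot. stability_path Z t $ i < 0"
      using u v
    proof eventually_elim
      case (elim t)
      then have "v $ i > 0" using pos[of t i] by simp
      then show ?case using elim by (simp add: stability_path_def field_simps)
    qed
  qed
  show "\<forall>\<^sub>F t in at_top. \<forall>i. stability_path Z t $ i > 0"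
  proof (rule eventually_all_finite)
    fix i :: 'n
    obtain u v where u: "\<forall>\<^sub>F t in at_top. real_path Z t = u" and v: "\<forall>\<^sub>F t in at_top. imag_path Z t = v"
      using eventually_constant(2)[OF a] eventually_constant(2)[OF b] by blast
    have "\<forall>\<^sub>F t::real in at_top. u $ i / v $ i < t" by (rule eventually_gt_at_top)
    then show "\<forall>\<^sub>F t in at_top. stability_path Z t $ i > 0"
      using u v
    proof eventually_elim
      case (elim t)
      then have "v $ i > 0" using pos[of t i] by simp
      then show ?case using elim by (simp add: stability_path_def field_simps)
    qed
  qed
qed

context fd_algebra_simples
begin

lemma inner_rdim_pos:
  assumes M: "M \<in> mod_objects" and nz: "nonzero_module M" and b: "\<And>i. b $ i > 0"
  shows "b \<bullet> rdim M > 0"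
proof -
  obtain j where "dimension_vector M $ j > 0" using dimension_vector_pos[OF M nz] by blast
  then have "0 < b $ j * rdim M $ j" using b by (simp add: rdim_def)
  then show ?thesis
    unfolding inner_vec_def inner_real_def
    by (intro sum_pos2[of UNIV j]) (auto simp: rdim_def intro!: mult_nonneg_nonneg less_imp_le[OF b])
qed

lemma rdim_nonzero:
  assumes "M \<in> mod_objects" "nonzero_module M"
  shows "rdim M \<noteq> 0"
  using inner_rdim_pos[OF assms, of "\<chi> i. 1"] by auto

section \<open>Dictionary between semistable pairs and the cones D(M)\<close>

context
  fixes Z :: "real \<Rightarrow> int ^ 'n \<Rightarrow> complex"
  assumes Z: "nonlinear_stability_function Z"
begin

lemma imag_path_rdim_pos: "M \<in> mod_objects \<Longrightarrow> nonzero_module M \<Longrightarrow> imag_path Z t \<bullet> rdim M > 0"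
  using Z by (intro inner_rdim_pos) (auto simp: nonlinear_stability_function_def)

lemma mem_H_iff:
  assumes "M \<in> mod_objects" "nonzero_module M"
  shows "stability_path Z t \<in> H M \<longleftrightarrow> slope Z t M = t"
  using imag_path_rdim_pos[OF assms, of t] by (auto simp: H_def slope_def stability_path_inner field_simps)

lemma inner_nonpos_iff:
  assumes "M \<in> mod_objects" "nonzero_module M"
  shows "stability_path Z t \<bullet> rdim M \<le> 0 \<longleftrightarrow> slope Z t M \<ge> t"
  using imag_path_rdim_pos[OF assms, of t] by (auto simp: slope_def stability_path_inner field_simps)

text \<open>On \<open>H M\<close> the number \<open>t\<close> is the slope of \<open>M\<close>, so
  for nonzero \<open>N\<close> the inequality in \<open>D M\<close> is exactly the one in
  semistability.\<close>

lemma mem_D_iff: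
  assumes M: "M \<in> mod_objects" and nz: "nonzero_module M"
  shows "stability_path Z t \<in> D M \<longleftrightarrow> (M, t) \<in> semistable_pairs Z"
proof (cases "slope Z t M = t")
  case True
  let ?g = "stability_path Z t"
  have g: "?g \<in> H M" using True mem_H_iff[OF M nz] by simp
  have sub: "?g \<bullet> rdim (M\<lparr>carrier := N\<rparr>) \<le> 0 \<longleftrightarrow> slope Z t (M\<lparr>carrier := N\<rparr>) \<ge> slope Z t M"
    if "submodule N \<Lambda> M" "N \<noteq> {\<zero>\<^bsub>M\<^esub>}" for N
    using inner_nonpos_iff[OF mod_objects_submodule[OF M that(1)], of t] that(2) True
    by (simp add: nonzero_module_def)
  \<comment> \<open>\<open>D\<close> also tests the submodules zero and \<open>M\<close>, which
    semistability leaves out; both give the value 0.\<close>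
  have triv: "?g \<bullet> rdim (M\<lparr>carrier := {\<zero>\<^bsub>M\<^esub>}\<rparr>) \<le> 0" "?g \<bullet> rdim (M\<lparr>carrier := carrier M\<rparr>) \<le> 0"
    using rdim_zero[OF M] g by (simp_all add: H_def)
  have "?g \<in> D M \<longleftrightarrow> semistable Z t M"
  proof
    assume "?g \<in> D M"
    then show "semistable Z t M" using sub nz by (simp add: D_def semistable_def)
  next
    assume ss: "semistable Z t M"
    have "?g \<bullet> rdim (M\<lparr>carrier := N\<rparr>) \<le> 0" if N: "submodule N \<Lambda> M" for N
    proof (cases "N = {\<zero>\<^bsub>M\<^esub>} \<or> N = carrier M")
      case True
      then show ?thesis using triv by auto
    next
      case False
      then show ?thesis using sub[OF N] ss N by (simp add: semistable_def)
    qed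
    then show "?g \<in> D M" using g by (simp add: D_def)
  qed
  then show ?thesis using M True by (simp add: semistable_pairs_def)
next
  case False
  then show ?thesis using mem_H_iff[OF M nz] by (auto simp: D_def semistable_pairs_def)
qed

lemma semistable_pairsD:
  assumes "(M, t) \<in> semistable_pairs Z"
  shows "M \<in> mod_objects" "nonzero_module M" "stability_path Z t \<in> D M"
proof -
  show "M \<in> mod_objects" "nonzero_module M" using assms by (auto simp: semistable_pairs_def semistable_def)
  then show "stability_path Z t \<in> D M" using assms by (simp add: mem_D_iff)
qed

lemma tangent_iff:
  assumes pair: "(M, t) \<in> semistable_pairs Z"
  shows "vector_derivative (stability_path Z) (at t) \<in> H M \<longleftrightarrow> deriv (\<lambda>t. slope Z t M) t = 1"
proof -
  note M = semistable_pairsD(1,2)[OF pair]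
  let ?d = "rdim M" and ?a = "real_path Z" and ?b = "imag_path Z"
  obtain a' b' where a': "(?a has_vector_derivative a') (at t)" and b': "(?b has_vector_derivative b') (at t)"
    using Z unfolding nonlinear_stability_function_def C1_differentiable_on_def by blast
  have ad: "((\<lambda>t. ?a t \<bullet> ?d) has_real_derivative a' \<bullet> ?d) (at t)"
    and bd: "((\<lambda>t. ?b t \<bullet> ?d) has_real_derivative b' \<bullet> ?d) (at t)"
    using bounded_linear.has_vector_derivative[OF bounded_linear_inner_left a']
      bounded_linear.has_vector_derivative[OF bounded_linear_inner_left b']
    by (simp_all add: has_real_derivative_iff_has_vector_derivative)
  have pos: "?b t \<bullet> ?d > 0" by (rule imag_path_rdim_pos[OF M])
  \<comment> \<open>A pair has slope \<open>t\<close>. Substituted into the quotient rule, this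
    cancels one factor of the denominator and leaves the derivative of the numerator minus
    \<open>t\<close> times that of the denominator.\<close>
  have slope: "?a t \<bullet> ?d = t * (?b t \<bullet> ?d)"
    using pair pos by (auto simp: semistable_pairs_def slope_def field_simps)
  have "deriv (\<lambda>t. slope Z t M) t =
      ((a' \<bullet> ?d) * (?b t \<bullet> ?d) - (?a t \<bullet> ?d) * (b' \<bullet> ?d)) / ((?b t \<bullet> ?d) * (?b t \<bullet> ?d))"
    unfolding slope_def using pos by (intro DERIV_imp_deriv DERIV_divide ad bd) auto
  also have "\<dots> = (a' \<bullet> ?d - t * (b' \<bullet> ?d)) / (?b t \<bullet> ?d)"
    unfolding slope using pos by (simp add: field_simps)
  finally have deriv: "deriv (\<lambda>t. slope Z t M) t = (a' \<bullet> ?d - t * (b' \<bullet> ?d)) / (?b t \<bullet> ?d)" .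
  have "deriv (\<lambda>t. slope Z t M) t = 1 \<longleftrightarrow> a' \<bullet> ?d - t * (b' \<bullet> ?d) = ?b t \<bullet> ?d"
    unfolding deriv using pos by auto
  moreover have "vector_derivative (stability_path Z) (at t) = t *\<^sub>R b' + ?b t - a'"
    by (rule vector_derivative_at[OF stability_path_has_vector_derivative[OF a' b']])
  ultimately show ?thesis by (auto simp: H_def inner_diff_left inner_add_left)
qed

text \<open>Submodules of \<open>N\<close> are submodules of \<open>M\<close>, so the inequalities
  for the cone of \<open>N\<close> come from \<open>D M\<close>; membership in the hyperplane of
  \<open>N\<close> is the equation assumed.\<close>

lemma submodule_semistable_pair:
  assumes pair: "(M, t) \<in> semistable_pairs Z" and N: "submodule N \<Lambda> M" "N \<noteq> {\<zero>\<^bsub>M\<^esub>}"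
    and 0: "stability_path Z t \<bullet> rdim (M\<lparr>carrier := N\<rparr>) = 0"
  shows "(M\<lparr>carrier := N\<rparr>, t) \<in> semistable_pairs Z"
proof -
  note M = semistable_pairsD[OF pair]
  have nz: "nonzero_module (M\<lparr>carrier := N\<rparr>)" using N by (simp add: nonzero_module_def)
  have "stability_path Z t \<in> D (M\<lparr>carrier := N\<rparr>)"
    using M(3) 0 right_module.submodule_restrict_iff[OF mod_objectsD(1)[OF M(1)] N(1)]
    by (auto simp: D_def H_def)
  then show ?thesis using mem_D_iff[OF mod_objects_submodule[OF M(1) N(1)] nz] by simp
qed

text \<open>A decomposable module of a semistable pair splits into two smaller ones of the same kind.\<close>

lemma rdims_proportional:
  assumes uniq: "\<And>M N. \<lbrakk>(M, t) \<in> semistable_pairs Z; indecomposable_module \<Lambda> M;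
      (N, t) \<in> semistable_pairs Z; indecomposable_module \<Lambda> N\<rbrakk> \<Longrightarrow> isomorphic_modules \<Lambda> M N"
  obtains d where "\<And>M. (M, t) \<in> semistable_pairs Z \<Longrightarrow> \<exists>c. rdim M = c *\<^sub>R d"
proof -
  \<comment> \<open>Any indecomposable module of a pair at time \<open>t\<close> gives the
    direction. Should there be none, \<open>d\<close> is an unspecified value; the induction
    evaluates it only when \<open>M\<close> itself is such a module.\<close>
  define d where "d = rdim (SOME M. (M, t) \<in> semistable_pairs Z \<and> indecomposable_module \<Lambda> M)"
  have "\<exists>c. rdim M = c *\<^sub>R d" if "(M, t) \<in> semistable_pairs Z" for M
    using that
  proof (induction "\<Sum>i\<in>UNIV. dimension_vector M $ i" arbitrary: M rule: less_induct)
    case less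
    note M = semistable_pairsD[OF less.prems]
    interpret M: right_module \<Lambda> M by (rule mod_objectsD(1)[OF M(1)])
    show ?case
    proof (cases "indecomposable_module \<Lambda> M")
      case True
      let ?P = "\<lambda>M. (M, t) \<in> semistable_pairs Z \<and> indecomposable_module \<Lambda> M"
      have P: "?P (Eps ?P)" using less.prems True by (intro someI[of ?P M]) simp
      then have "rdim M = d"
        unfolding d_def
        using less.prems True by (intro rdim_isomorphic M(1) uniq semistable_pairsD(1)[of _ t]) auto
      then show ?thesis by (intro exI[of _ 1]) simp
    next
      case False
      then obtain A B where AB: "submodule A \<Lambda> M" "submodule B \<Lambda> M" "A <+>\<^bsub>M\<^esub> B = carrier M"
        "A \<inter> B = {\<zero>\<^bsub>M\<^esub>}" "A \<noteq> {\<zero>\<^bsub>M\<^esub>}" "B \<noteq> {\<zero>\<^bsub>M\<^esub>}"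
        using M(2) unfolding indecomposable_module_def by blast
      let ?A = "M\<lparr>carrier := A\<rparr>" and ?B = "M\<lparr>carrier := B\<rparr>" and ?g = "stability_path Z t"
      have sum: "rdim M = rdim ?A + rdim ?B" by (rule rdim_direct_sum[OF M(1) AB(1-4)])
      have "?g \<bullet> rdim ?A \<le> 0" "?g \<bullet> rdim ?B \<le> 0" "?g \<bullet> rdim M = 0"
        using M(3) AB(1,2) by (auto simp: D_def H_def)
      \<comment> \<open>Two nonpositive numbers with sum zero both vanish, so both summands form
        pairs again.\<close>
      then have "?g \<bullet> rdim ?A = 0" "?g \<bullet> rdim ?B = 0" by (auto simp: sum inner_add_right)
      then have pairs: "(?A, t) \<in> semistable_pairs Z" "(?B, t) \<in> semistable_pairs Z"
        using submodule_semistable_pair[OF less.prems] AB by auto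
      have dv: "dimension_vector M $ i = dimension_vector ?A $ i + dimension_vector ?B $ i" for i
        using sum by (simp add: rdim_def vec_eq_iff flip: of_nat_add)
      \<comment> \<open>The other summand has positive total dimension, so each summand is strictly
        smaller than \<open>M\<close>.\<close>
      have pos: "(\<Sum>i\<in>UNIV. dimension_vector N $ i) > 0" if N: "(N, t) \<in> semistable_pairs Z" for N
        using dimension_vector_pos[OF semistable_pairsD(1,2)[OF N]] by (auto simp: sum_pos2)
      have "(\<Sum>i\<in>UNIV. dimension_vector ?A $ i) < (\<Sum>i\<in>UNIV. dimension_vector M $ i)"
        "(\<Sum>i\<in>UNIV. dimension_vector ?B $ i) < (\<Sum>i\<in>UNIV. dimension_vector M $ i)"
        using pos[OF pairs(1)] pos[OF pairs(2)] by (simp_all add: dv sum.distrib)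
      from less.hyps[OF this(1) pairs(1)] less.hyps[OF this(2) pairs(2)]
      obtain c e where "rdim ?A = c *\<^sub>R d" "rdim ?B = e *\<^sub>R d" by blast
      then have "rdim M = (c + e) *\<^sub>R d" by (simp add: sum scaleR_left_distrib)
      then show ?thesis by blast
    qed
  qed
  then show thesis by (rule that)
qed

text \<open>There may be infinitely many submodules, but the entries of their dimension vectors are
  natural numbers bounded by those of \<open>M\<close>.\<close>

lemma finite_submodule_rdims:
  assumes M: "M \<in> mod_objects"
  shows "finite {rdim (M\<lparr>carrier := N\<rparr>) | N. submodule N \<Lambda> M}"
proof (rule finite_subset)
  let ?F = "PiE UNIV (\<lambda>i. {..dimension_vector M $ i})"
  show "{rdim (M\<lparr>carrier := N\<rparr>) | N. submodule N \<Lambda> M} \<subseteq> (\<lambda>v. \<chi> i. real (v i)) ` ?F"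
  proof clarify
    fix N assume N: "submodule N \<Lambda> M"
    show "rdim (M\<lparr>carrier := N\<rparr>) \<in> (\<lambda>v. \<chi> i. real (v i)) ` ?F"
      using dimension_vector_mono[OF M N]
      by (intro image_eqI[of _ _ "\<lambda>i. dimension_vector (M\<lparr>carrier := N\<rparr>) $ i"]) (auto simp: rdim_def)
  qed
  show "finite ((\<lambda>v. \<chi> i. real (v i)) ` ?F :: (real ^ 'n) set)"
    by (intro finite_imageI finite_PiE) auto
qed

lemma aff_dim_D:
  assumes uniq: "\<And>M N. \<lbrakk>(M, t) \<in> semistable_pairs Z; indecomposable_module \<Lambda> M;
      (N, t) \<in> semistable_pairs Z; indecomposable_module \<Lambda> N\<rbrakk> \<Longrightarrow> isomorphic_modules \<Lambda> M N"
    and pair: "(M, t) \<in> semistable_pairs Z"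
  shows "aff_dim (D M) = int CARD('n) - 1"
proof -
  note M = semistable_pairsD[OF pair]
  let ?g = "stability_path Z t"
  obtain d where d: "\<And>N. (N, t) \<in> semistable_pairs Z \<Longrightarrow> \<exists>c. rdim N = c *\<^sub>R d"
    using rdims_proportional[of t] uniq by blast
  \<comment> \<open>The vectors whose inequality is strict at \<open>?g\<close>. They alone limit
    how far a point may move away from \<open>?g\<close> within the hyperplane, and finitely many of
    them cut out the open set \<open>U\<close>.\<close>
  define V where "V = {v. (\<exists>N. v = rdim (M\<lparr>carrier := N\<rparr>) \<and> submodule N \<Lambda> M) \<and> ?g \<bullet> v < 0}"
  define U where "U = (\<Inter>v\<in>V. {x. x \<bullet> v < 0})"
  have "finite V" unfolding V_def by (rule finite_subset[OF _ finite_submodule_rdims[OF M(1)]]) auto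
  then have "open U"
    unfolding U_def by (intro open_INT) (auto simp: inner_commute[of _ "_ :: real ^ 'n"] open_halfspace_lt)
  have H: "H M = {x. rdim M \<bullet> x = 0}" by (simp add: H_def inner_commute)
  have dim_H: "aff_dim (H M) = int CARD('n) - 1"
    using aff_dim_hyperplane[OF rdim_nonzero[OF M(1,2)], of 0] unfolding H by simp
  have "H M \<inter> U \<subseteq> D M"
  proof
    fix x assume x: "x \<in> H M \<inter> U"
    have "x \<bullet> rdim (M\<lparr>carrier := N\<rparr>) \<le> 0" if N: "submodule N \<Lambda> M" for N
    proof -
      let ?v = "rdim (M\<lparr>carrier := N\<rparr>)"
      consider "?g \<bullet> ?v < 0" | "N = {\<zero>\<^bsub>M\<^esub>}" | "?g \<bullet> ?v = 0" "N \<noteq> {\<zero>\<^bsub>M\<^esub>}"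
        using M(3) N by (fastforce simp: D_def)
      then show ?thesis
      proof cases
        case 1
        then have "?v \<in> V" using N by (auto simp: V_def)
        then show ?thesis using x by (auto simp: U_def)
      next
        case 2
        then show ?thesis using rdim_zero[OF M(1)] by simp
      next
        case 3
        obtain c e where "?v = c *\<^sub>R d" and e: "rdim M = e *\<^sub>R d"
          using d[OF submodule_semistable_pair[OF pair N 3(2,1)]] d[OF pair] by blast
        \<comment> \<open>\<open>rdim M\<close> is nonzero, hence so is \<open>e\<close>, and
          orthogonality of \<open>x\<close> to \<open>rdim M\<close> passes to \<open>d\<close> and
          from there to \<open>?v\<close>.\<close>
        moreover have "x \<bullet> d = 0"
          using x e rdim_nonzero[OF M(1,2)] by (auto simp: H_def)
        ultimately show ?thesis by simp
      qed
    qed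
    then show "x \<in> D M" using x by (simp add: D_def)
  qed
  then have "aff_dim (H M \<inter> U) \<le> aff_dim (D M)" by (rule aff_dim_subset)
  moreover have "?g \<in> H M \<inter> U" using M(3) by (auto simp: U_def V_def D_def)
  then have "aff_dim (H M \<inter> U) = aff_dim (H M)"
    by (intro aff_dim_convex_Int_open \<open>open U\<close>) (auto simp: H convex_hyperplane)
  moreover have "aff_dim (D M) \<le> aff_dim (H M)" by (rule aff_dim_subset) (auto simp: D_def)
  ultimately show ?thesis using dim_H by simp
qed

section \<open>The two implications\<close>

lemma indecomposable_pair_iff:
  assumes "indecomposable_module \<Lambda> M"
  shows "(M, t) \<in> semistable_pairs Z \<longleftrightarrow> M \<in> mod_objects \<and> stability_path Z t \<in> D M"
  using assms mem_D_iff[of M t] semistable_pairsD(1)[of M t] by (auto simp: indecomposable_module_def)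

text \<open>Distinctness of the times in \<open>P\<close> makes the indecomposable module at each
  time unique up to isomorphism. This is the uniqueness demanded of the path and, through
  \<open>aff_dim_D\<close>, the source of codimension 1.\<close>

lemma finite_stability_imp_finite_path:
  assumes "finite_stability Z"
  shows "finite_path (stability_path Z)"
proof -
  have gen: "generic_stability Z" using assms by (simp add: finite_stability_def)
  obtain P where P: "finite P" "P \<subseteq> {(M, t) \<in> semistable_pairs Z. indecomposable_module \<Lambda> M}"
    "inj_on snd P"
    and rep: "\<forall>(M, t) \<in> semistable_pairs Z. indecomposable_module \<Lambda> M \<longrightarrow>
        (\<exists>(M', t') \<in> P. isomorphic_modules \<Lambda> M M' \<and> t = t')"
    using assms unfolding finite_stability_def by (elim conjE exE) (rule that)
  have P_rep: "\<exists>M'. (M', t) \<in> P \<and> isomorphic_modules \<Lambda> M M'"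
    if "(M, t) \<in> semistable_pairs Z" "indecomposable_module \<Lambda> M" for M t
    using bspec[OF rep that(1)] that(2) by auto
  have uniq: "isomorphic_modules \<Lambda> M N"
    if M: "(M, t) \<in> semistable_pairs Z" "indecomposable_module \<Lambda> M"
      and N: "(N, t) \<in> semistable_pairs Z" "indecomposable_module \<Lambda> N" for M N t
  proof -
    obtain M' N' where *: "(M', t) \<in> P" "isomorphic_modules \<Lambda> M M'" "(N', t) \<in> P" "isomorphic_modules \<Lambda> N N'"
      using P_rep[OF M] P_rep[OF N] by blast
    then have "M' = N'" using inj_onD[OF P(3), of "(M', t)" "(N', t)"] by simp
    have N': "(N', t) \<in> semistable_pairs Z" using *(3) P(2) by auto
    have "isomorphic_modules \<Lambda> N' N"
      by (rule right_module.isomorphic_sym[OF _ _ *(4)])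
        (rule mod_objectsD(1), rule semistable_pairsD(1), rule N N')+
    then show ?thesis using isomorphic_modules_trans[OF *(2)] \<open>M' = N'\<close> by simp
  qed
  have "aff_dim (D M) = int CARD('n) - 1 \<and> vector_derivative (stability_path Z) (at t) \<notin> H M"
    if "M \<in> mod_objects" "nonzero_module M" "stability_path Z t \<in> D M" for M t
  proof -
    have pair: "(M, t) \<in> semistable_pairs Z" using that mem_D_iff by simp
    then have "deriv (\<lambda>t. slope Z t M) t \<noteq> 1" using gen by (auto simp: generic_stability_def)
    moreover have "aff_dim (D M) = int CARD('n) - 1" by (rule aff_dim_D[OF uniq pair])
    ultimately show ?thesis using tangent_iff[OF pair] by simp
  qed
  then have "reddening_path (stability_path Z)"
    using stability_path_C1[OF Z] stability_path_sign[OF Z] unfolding reddening_path_def by blast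
  moreover have "{t. \<exists>M \<in> mod_objects. indecomposable_module \<Lambda> M \<and> stability_path Z t \<in> D M} \<subseteq> snd ` P"
  proof clarify
    fix t M assume "M \<in> mod_objects" "indecomposable_module \<Lambda> M" "stability_path Z t \<in> D M"
    then obtain M' where "(M', t) \<in> P" using P_rep[of M t] indecomposable_pair_iff by blast
    then show "t \<in> snd ` P" by force
  qed
  then have "finite {t. \<exists>M \<in> mod_objects. indecomposable_module \<Lambda> M \<and> stability_path Z t \<in> D M}"
    using P(1) finite_surj by blast
  moreover have "isomorphic_modules \<Lambda> M N"
    if "M \<in> mod_objects" "N \<in> mod_objects" "indecomposable_module \<Lambda> M" "indecomposable_module \<Lambda> N"
      "stability_path Z t \<in> D M" "stability_path Z t \<in> D N" for t M N
    using that by (intro uniq[of M t N]) (simp_all add: indecomposable_pair_iff)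
  ultimately show ?thesis unfolding finite_path_def by blast
qed

text \<open>Uniqueness at each time allows a single representative \<open>R t\<close> per
  exceptional time. As \<open>P\<close> consists of the points \<open>(R t, t)\<close>, its times
  are distinct by construction.\<close>

lemma finite_path_imp_finite_stability:
  assumes "finite_path (stability_path Z)"
  shows "finite_stability Z"
proof -
  have gen: "generic_stability Z"
    unfolding generic_stability_def
  proof clarify
    fix M t assume pair: "(M, t) \<in> semistable_pairs Z" and "deriv (\<lambda>t. slope Z t M) t = 1"
    then have "vector_derivative (stability_path Z) (at t) \<in> H M" using tangent_iff by simp
    moreover have "vector_derivative (stability_path Z) (at t) \<notin> H M"
      using assms semistable_pairsD[OF pair] by (simp add: finite_path_def reddening_path_def)
    ultimately show False by blast
  qed
  let ?Q = "\<lambda>t M. (M, t) \<in> semistable_pairs Z \<and> indecomposable_module \<Lambda> M"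
  let ?T = "{t. \<exists>M. ?Q t M}"
  define R where "R t = (SOME M. ?Q t M)" for t
  define P where "P = (\<lambda>t. (R t, t)) ` ?T"
  have R: "?Q t (R t)" if "?Q t M" for t M
    unfolding R_def using that by (rule someI[of "?Q t"])
  have "finite P"
  proof -
    have "?T = {t. \<exists>M \<in> mod_objects. indecomposable_module \<Lambda> M \<and> stability_path Z t \<in> D M}"
      using indecomposable_pair_iff by auto
    then show ?thesis using assms by (simp add: P_def finite_path_def)
  qed
  moreover have "P \<subseteq> {(M, t) \<in> semistable_pairs Z. indecomposable_module \<Lambda> M}"
    using R by (auto simp: P_def)
  moreover have "\<forall>(M, t) \<in> semistable_pairs Z. indecomposable_module \<Lambda> M \<longrightarrow>
      (\<exists>(M', t') \<in> P. isomorphic_modules \<Lambda> M M' \<and> t = t')"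
  proof clarify
    fix M t assume M: "(M, t) \<in> semistable_pairs Z" "indecomposable_module \<Lambda> M"
    have Rt: "(R t, t) \<in> semistable_pairs Z" "indecomposable_module \<Lambda> (R t)" using R[of M t] M by auto
    have "isomorphic_modules \<Lambda> M (R t)"
      using assms M Rt semistable_pairsD[OF M(1)] semistable_pairsD[OF Rt(1)]
      unfolding finite_path_def by blast
    moreover have "(R t, t) \<in> P" using M by (auto simp: P_def)
    ultimately show "\<exists>(M', t') \<in> P. isomorphic_modules \<Lambda> M M' \<and> t = t'" by blast
  qed
  moreover have "inj_on snd P" by (auto simp: P_def inj_on_def)
  ultimately show ?thesis
    unfolding finite_stability_def by (intro conjI gen exI[of _ P])
qed

end

end

theorem proposition3p5:
  fixes K :: "'k ring" and \<Lambda> :: "('k, 'a) module"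
    and S :: "'n::finite \<Rightarrow> ('a, nat \<Rightarrow> 'k) module"
    and Z :: "real \<Rightarrow> int ^ 'n \<Rightarrow> complex"
  assumes "fd_algebra_simples K \<Lambda> S"
    and "nonlinear_stability_function Z"
  shows "fd_algebra_simples.finite_stability K \<Lambda> S Z \<longleftrightarrow>
         fd_algebra_simples.finite_path K \<Lambda> S (stability_path Z)"
  using fd_algebra_simples.finite_stability_imp_finite_path[OF assms]
    fd_algebra_simples.finite_path_imp_finite_stability[OF assms] by blast

end
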